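(* There is a constant $c>0$ such that the following holds. Let $\mathcal{A}$ be a simple arrangement of $n$ pseudocircles in which every pseudocircle intersects at least three other pseudocircles. Then the ratio of the number of triangles of $\mathcal{A}$ to the total number of cells of $\mathcal{A}$ is at most $5/6+c/n$.
   Context: A pseudocircle is a simple closed curve on the sphere. An arrangement of pseudocircles is a finite collection of pseudocircles such that any two are either disjoint or intersect in exactly two points, at which they cross; it is simple if no three pseudocircles share a point. The arrangement is not assumed to be pairwise intersecting. The cells are the components of the complement of the union of the pseudocircles on the sphere; a triangle is a cell with exactly $3$ crossings on its boundary. *)

theory Defs
  imports "HOL-Analysis.Analysis"
begin

definition S2 :: "(real^3) set" where
  "S2 = sphere 0 1"

definition pseudocircle :: "(real^3) set \<Rightarrow> bool" where
  "pseudocircle g \<longleftrightarrow> g \<subseteq> S2 \<and> g homeomorphic (sphere (0::complex) 1)"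

text \<open>g crosses d: g meets two different components of S2 minus d
  (for two pseudocircles meeting in exactly two points this says that they cross
  there rather than touch).\<close>
definition crosses :: "(real^3) set \<Rightarrow> (real^3) set \<Rightarrow> bool" where
  "crosses g d \<longleftrightarrow> (\<exists>C1 C2. C1 \<in> components (S2 - d) \<and> C2 \<in> components (S2 - d)
      \<and> C1 \<noteq> C2 \<and> g \<inter> C1 \<noteq> {} \<and> g \<inter> C2 \<noteq> {})"

definition pc_arrangement :: "(real^3) set set \<Rightarrow> bool" where
  "pc_arrangement A \<longleftrightarrow> finite A \<and> (\<forall>g\<in>A. pseudocircle g) \<and>
     (\<forall>g\<in>A. \<forall>d\<in>A. g \<noteq> d \<longrightarrow>
        g \<inter> d = {} \<or> (card (g \<inter> d) = 2 \<and> crosses g d \<and> crosses d g))"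

definition simple_arrangement :: "(real^3) set set \<Rightarrow> bool" where
  "simple_arrangement A \<longleftrightarrow> (\<forall>g\<in>A. \<forall>d\<in>A. \<forall>e\<in>A.
      g \<noteq> d \<and> g \<noteq> e \<and> d \<noteq> e \<longrightarrow> g \<inter> d \<inter> e = {})"

definition cells :: "(real^3) set set \<Rightarrow> (real^3) set set" where
  "cells A = components (S2 - \<Union>A)"

definition crossings :: "(real^3) set set \<Rightarrow> (real^3) set" where
  "crossings A = {p. \<exists>g\<in>A. \<exists>d\<in>A. g \<noteq> d \<and> p \<in> g \<and> p \<in> d}"

definition triangles :: "(real^3) set set \<Rightarrow> (real^3) set set" where
  "triangles A = {C \<in> cells A. card (crossings A \<inter> frontier C) = 3}"

end

theory Submission
  imports Defs "HOL-Complex_Analysis.Contour_Integration"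
begin

text \<open>In fact every such arrangement has at most \<open>5/6\<close> times as many triangles as cells.

  Call two crossings adjacent if they bound an edge. A triangle has corners \<open>p, q, r\<close> that are pairwise
  adjacent along three different curves, and different triangles have different corner sets, so
  it suffices to bound the number of such triples. At a crossing \<open>p\<close> of \<open>g\<close> and \<open>d\<close> two
  triangles sharing an edge force their third sides onto one curve. Hence four triangles at \<open>p\<close> would
  be enclosed by a curve with only four crossings, whereas every curve has at least six. So at most three
  triangles meet at \<open>p\<close>. If three do, then either a neighbour \<open>x\<close> of \<open>p\<close> lies in just two
  triangles, and these share the edge \<open>xp\<close>; or three curves form an octahedron near \<open>p\<close>, and the
  second crossing of \<open>g\<close> and \<open>d\<close> lies in at most two triangles, which do not share an edge. This charging is injective,
  so a crossing lies in \<open>5/2\<close> triangles on average, and there are at most \<open>5/6\<close> as many triangles as crossings.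

  There are at least as many cells as crossings: inserting the edges one at a time, each insertion
  either joins two components of the skeleton or, by the Jordan curve theorem, splits a face.

  That the corners of a cell look as expected follows from Janiszewski's theorem on the sphere: two points
  separated neither by \<open>S\<close> nor by \<open>T\<close> are not separated by \<open>S \<union> T\<close> if \<open>S \<inter> T\<close> is connected.\<close>

section \<open>Counting triples of consecutive crossings\<close>

text \<open>Three mutually crossing curves can form an octahedron: all eight cells are triangles and
  every crossing lies in four of them. Each curve then has only four crossings. The hypothesis on
  neighbours enters the counting as \<open>many\<close>, which forbids four consecutive crossings
  from closing up. Most of an octahedron can still occur, and then the neighbours of a crossing with
  three triangles may be as rich as the crossing itself; this obstacle forces the second kind of
  charge. The two kinds cannot collide: whether the triangles at the charged crossing share an edge
  tells which kind it received.

  The counting sees only incidences and consecutive crossings, so its locale is free of topology;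
  \<open>adj_closed\<close> says there that every curve is a single cycle. The topological half has
  no planar map to rely on. Its core is that a cell with a crossing on its boundary follows exactly
  one of the two edges there on each curve. For cells only a lower bound is wanted, so an inequality
  of Euler type is enough.\<close>

locale curve_system =
  fixes A :: "'p set set" and X :: "'p set" and adj :: "'p set \<Rightarrow> 'p \<Rightarrow> 'p \<Rightarrow> bool"
  assumes finite_X: "finite X"
    and on_two: "p \<in> X \<Longrightarrow> \<exists>g\<in>A. \<exists>d\<in>A. g \<noteq> d \<and> p \<in> g \<and> p \<in> d"
    and on_X: "\<lbrakk>g \<in> A; d \<in> A; g \<noteq> d; p \<in> g; p \<in> d\<rbrakk> \<Longrightarrow> p \<in> X"
    and no_three: "\<lbrakk>g \<in> A; d \<in> A; e \<in> A; g \<noteq> d; g \<noteq> e; d \<noteq> e; p \<in> g; p \<in> d\<rbrakk> \<Longrightarrow> p \<notin> e"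
    and meet_twice: "\<lbrakk>g \<in> A; d \<in> A; g \<noteq> d; p \<in> g; p \<in> d; q \<in> g; q \<in> d; r \<in> g; r \<in> d; p \<noteq> q; p \<noteq> r\<rbrakk>
        \<Longrightarrow> q = r"
    and adj_in: "\<lbrakk>g \<in> A; adj g p q\<rbrakk> \<Longrightarrow> p \<in> g \<and> p \<in> X \<and> p \<noteq> q"
    and adj_sym: "adj g p q \<Longrightarrow> adj g q p"
    and adj_two: "\<lbrakk>g \<in> A; p \<in> g; p \<in> X\<rbrakk> \<Longrightarrow> \<exists>q1 q2. q1 \<noteq> q2 \<and> (\<forall>q. adj g p q \<longleftrightarrow> q = q1 \<or> q = q2)"
    and adj_closed: "\<lbrakk>g \<in> A; S \<subseteq> g \<inter> X; S \<noteq> {}; \<And>p q. \<lbrakk>p \<in> S; adj g p q\<rbrakk> \<Longrightarrow> q \<in> S\<rbrakk> \<Longrightarrow> S = g \<inter> X"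
    and many: "g \<in> A \<Longrightarrow> card (g \<inter> X) > 4"
begin

text \<open>The triple is kept as an unordered set, so that a triangle is counted once whichever
  corner is named first.\<close>

definition Tri :: "'p set set" where
  "Tri = {T. \<exists>p q r. \<exists>g\<in>A. \<exists>d\<in>A. \<exists>a\<in>A. T = {p, q, r} \<and> g \<noteq> d \<and> a \<noteq> g \<and> a \<noteq> d
      \<and> adj g p q \<and> adj d p r \<and> adj a q r}"

lemma adj_inD:
  assumes "g \<in> A" "adj g p q"
  shows "p \<in> g" "p \<in> X" "q \<in> g" "q \<in> X" "p \<noteq> q"
  using adj_in[OF assms] adj_in[OF assms(1) adj_sym[OF assms(2)]] by auto

lemma adj_third:
  assumes "g \<in> A" "adj g p q" "adj g p q'" "q \<noteq> q'" "adj g p y"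
  shows "y = q \<or> y = q'"
proof -
  have "p \<in> g" "p \<in> X" using adj_inD assms by auto
  then obtain q1 q2 where "\<forall>q. adj g p q \<longleftrightarrow> q = q1 \<or> q = q2" using adj_two assms(1) by blast
  then show ?thesis using assms by metis
qed

lemma Tri_sub: "T \<in> Tri \<Longrightarrow> T \<subseteq> X"
  unfolding Tri_def using adj_inD by (smt (verit, ccfv_threshold) empty_subsetI insert_subset mem_Collect_eq)

lemma card_Tri: assumes "T \<in> Tri" shows "card T = 3"
proof -
  obtain p q r g d a where *: "g \<in> A" "d \<in> A" "a \<in> A" "T = {p, q, r}" "adj g p q" "adj d p r" "adj a q r"
    using assms unfolding Tri_def by blast
  have "p \<noteq> q" "p \<noteq> r" "q \<noteq> r" using adj_inD * by metis+
  then show ?thesis using * by simp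
qed

lemma finite_Tri: "finite Tri"
  by (rule finite_subset[of _ "Pow X"]) (use Tri_sub finite_X in auto)

lemma two_curves:
  assumes "g \<in> A" "d \<in> A" "g \<noteq> d" "p \<in> g" "p \<in> d" "e \<in> A" "p \<in> e"
  shows "e = g \<or> e = d"
  using no_three assms by blast

text \<open>A normal form of the definition: any corner may play the first role, and the two curves
  through it may be taken in a prescribed order, because no other curve passes through that
  corner.\<close>

lemma Tri_at:
  assumes T: "T \<in> Tri" and p: "p \<in> T" "g \<in> A" "d \<in> A" "g \<noteq> d" "p \<in> g" "p \<in> d"
  obtains q r a where "T = {p, q, r}" "a \<in> A" "a \<noteq> g" "a \<noteq> d" "adj g p q" "adj d p r" "adj a q r"
proof -
  note result = that
  have base: thesis if h: "T = {p, q, r}" "h \<in> A" "k \<in> A" "a \<in> A" "h \<noteq> k" "a \<noteq> h" "a \<noteq> k"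
      "adj h p q" "adj k p r" "adj a q r" for h k a q r
  proof -
    have "p \<in> h" "p \<in> k" using adj_inD h by auto
    then have "h = g \<and> k = d \<or> h = d \<and> k = g" using two_curves p h by metis
    then show thesis
    proof
      assume "h = g \<and> k = d" then show thesis using result[of q r a] h by auto
    next
      assume "h = d \<and> k = g" then show thesis using result[of r q a] h adj_sym by auto
    qed
  qed
  obtain u v w h k a where *: "h \<in> A" "k \<in> A" "a \<in> A" "T = {u, v, w}" "h \<noteq> k" "a \<noteq> h" "a \<noteq> k"
      "adj h u v" "adj k u w" "adj a v w"
    using T unfolding Tri_def by blast
  consider "p = u" | "p = v" | "p = w" using p * by auto
  then show thesis
  proof cases
    case 1 then show ?thesis using base[of v w h k a] * by auto
  next
    case 2 then show ?thesis using base[of u w h a k] * adj_sym by (auto simp: insert_commute)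
  next
    case 3 then show ?thesis using base[of u v k a h] * adj_sym by (auto simp: insert_commute)
  qed
qed

text \<open>The corner \<open>q\<close> lies on \<open>g\<close> and on the third curve, hence by
  simplicity not on \<open>d\<close>; likewise \<open>r\<close> is not on \<open>g\<close>. So the
  unordered triple still tells its two neighbours of \<open>p\<close> apart.\<close>

lemma Tri_third:
  assumes T: "{p, q, r} \<in> Tri" and g: "g \<in> A" "d \<in> A" "g \<noteq> d" and adj: "adj g p q" "adj d p r"
  obtains a where "a \<in> A" "a \<noteq> g" "a \<noteq> d" "adj a q r" "q \<in> a" "r \<in> a" "q \<in> g" "r \<in> d" "q \<notin> d" "r \<notin> g"
    "q \<noteq> r" "p \<notin> a"
proof -
  have p: "p \<in> g" "p \<in> d" using adj_inD g adj by auto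
  obtain q' r' a where *: "{p, q, r} = {p, q', r'}" "a \<in> A" "a \<noteq> g" "a \<noteq> d" "adj g p q'" "adj d p r'" "adj a q' r'"
    by (rule Tri_at[OF T _ g p]) auto
  have in1: "q' \<in> a" "r' \<in> a" "q' \<in> g" "r' \<in> d" "q' \<noteq> r'" "p \<noteq> q'" "p \<noteq> r'" using adj_inD * g by metis+
  have "q' \<notin> d" "r' \<notin> g" using no_three in1 * g by metis+
  moreover have "p \<noteq> q" "p \<noteq> r" "q \<in> g" "r \<in> d" using adj adj_inD g by metis+
  ultimately have "q' = q" "r' = r" using *(1) in1 by auto
  then show thesis using that[of a] * in1 \<open>q' \<notin> d\<close> \<open>r' \<notin> g\<close> no_three g p by blast
qed

text \<open>Both third sides pass through \<open>r\<close>, where only one curve \<open>a\<close>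
  besides \<open>d\<close> is available. As a result \<open>q\<close>, \<open>r\<close>,
  \<open>q'\<close> are consecutive on \<open>a\<close>.\<close>

lemma two_triangles:
  assumes T: "{p, q, r} \<in> Tri" "{p, q', r} \<in> Tri" and g: "g \<in> A" "d \<in> A" "g \<noteq> d"
    and adj: "adj g p q" "adj g p q'" "adj d p r"
  obtains a where "a \<in> A" "a \<noteq> g" "a \<noteq> d" "adj a q r" "adj a q' r" "q \<in> a" "r \<in> a" "q' \<in> a"
    "p \<notin> a" "q \<notin> d" "q' \<notin> d" "r \<notin> g"
proof -
  obtain a where a: "a \<in> A" "a \<noteq> g" "a \<noteq> d" "adj a q r" "q \<in> a" "r \<in> a" "q \<notin> d" "r \<in> d" "r \<notin> g" "p \<notin> a"
    using Tri_third[OF T(1) g adj(1,3)] by metis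
  obtain b where b: "b \<in> A" "b \<noteq> g" "b \<noteq> d" "adj b q' r" "q' \<in> b" "r \<in> b" "q' \<notin> d"
    using Tri_third[OF T(2) g adj(2,3)] by metis
  have "a = b" using two_curves a b g by metis
  then show thesis using that a b by metis
qed

text \<open>The four points already contain both neighbours of each of them, so they would be all
  crossings of \<open>g\<close>.\<close>

lemma no_four_cycle:
  assumes "g \<in> A" "adj g p q" "adj g q r" "adj g r s" "adj g s p" "p \<noteq> r" "q \<noteq> s"
  shows False
proof -
  have "{p, q, r, s} = g \<inter> X"
  proof (rule adj_closed[OF assms(1)])
    show "{p, q, r, s} \<subseteq> g \<inter> X" using adj_inD assms by auto
    fix x y assume xy: "x \<in> {p, q, r, s}" "adj g x y"
    have sym: "adj g q p" "adj g r q" "adj g s r" "adj g p s" using assms adj_sym by auto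
    show "y \<in> {p, q, r, s}"
      using xy adj_third[OF assms(1) assms(2) sym(4) assms(7)] adj_third[OF assms(1) assms(3) sym(1)]
        adj_third[OF assms(1) assms(4) sym(2)] adj_third[OF assms(1) assms(5) sym(3)] assms(6,7) by auto
  qed auto
  moreover have "card {p, q, r, s} \<le> 4" by (simp add: card_insert_if)
  ultimately have "card (g \<inter> X) \<le> 4" by simp
  then show False using many[OF assms(1)] by simp
qed

section \<open>The number of triangles at a crossing\<close>

definition tdeg :: "'p \<Rightarrow> nat" where
  "tdeg p = card {T \<in> Tri. p \<in> T}"

text \<open>One candidate for each of the four sectors at \<open>p\<close>.\<close>

lemma Tri_at_subset:
  assumes g: "g \<in> A" "d \<in> A" "g \<noteq> d" and q: "adj g p q1" "adj g p q2" "q1 \<noteq> q2"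
    and r: "adj d p r1" "adj d p r2" "r1 \<noteq> r2"
  shows "{T \<in> Tri. p \<in> T} \<subseteq> {{p, q1, r1}, {p, q1, r2}, {p, q2, r1}, {p, q2, r2}}"
proof
  fix T assume T: "T \<in> {T \<in> Tri. p \<in> T}"
  have p: "p \<in> g" "p \<in> d" using adj_inD g q r by auto
  obtain q r a where "T = {p, q, r}" "adj g p q" "adj d p r"
    using T by (elim CollectE conjE) (rule Tri_at[OF _ _ g p])
  then show "T \<in> {{p, q1, r1}, {p, q1, r2}, {p, q2, r1}, {p, q2, r2}}"
    using adj_third[OF g(1) q, of q] adj_third[OF g(2) r, of r] by auto
qed

text \<open>The third curve passes through the corners \<open>q, r, q', r'\<close> in this order; a fourth triangle at
  \<open>p\<close> would close it up with only four crossings.\<close>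

lemma not_four_triangles:
  assumes g: "g \<in> A" "d \<in> A" "g \<noteq> d" and q: "adj g p q" "adj g p q'" "q \<noteq> q'"
    and r: "adj d p r" "adj d p r'" "r \<noteq> r'"
    and T: "{p, q, r} \<in> Tri" "{p, q', r} \<in> Tri" "{p, q', r'} \<in> Tri"
  shows "{p, q, r'} \<notin> Tri"
proof
  assume T4: "{p, q, r'} \<in> Tri"
  obtain a where a: "a \<in> A" "a \<noteq> g" "a \<noteq> d" "adj a q r" "adj a q' r" "q \<in> a" "q' \<in> a"
    using two_triangles[OF T(1,2) g q(1,2) r(1)] by metis
  obtain b where b: "b \<in> A" "b \<noteq> g" "b \<noteq> d" "adj b q r'" "adj b q' r'" "q' \<in> b" "q \<in> b"
    using two_triangles[OF T4 T(3) g q(1,2) r(2)] by metis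
  have "q \<in> g" using adj_inD g q by metis
  then have "a = b" using two_curves[of g a q b] a b g by metis
  then show False using no_four_cycle[of a q r q' r'] a b q r adj_sym by metis
qed

lemma nbrs_at:
  assumes "p \<in> X"
  obtains g d q1 q2 r1 r2 where "g \<in> A" "d \<in> A" "g \<noteq> d" "adj g p q1" "adj g p q2" "q1 \<noteq> q2"
    "adj d p r1" "adj d p r2" "r1 \<noteq> r2"
proof -
  obtain g d where g: "g \<in> A" "d \<in> A" "g \<noteq> d" "p \<in> g" "p \<in> d" using on_two[OF assms] by blast
  obtain q1 q2 where "q1 \<noteq> q2" "adj g p q1" "adj g p q2" using adj_two[OF g(1) g(4) assms] by blast
  moreover obtain r1 r2 where "r1 \<noteq> r2" "adj d p r1" "adj d p r2" using adj_two[OF g(2) g(5) assms] by blast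
  ultimately show thesis using that g by metis
qed

lemma card4_sub3:
  assumes "S \<subseteq> {a, b, c, d}" "d \<notin> S" shows "card S \<le> 3"
proof -
  have "S \<subseteq> {a, b, c}" using assms by auto
  then have "card S \<le> card {a, b, c}" by (rule card_mono[rotated]) auto
  also have "\<dots> \<le> 3" by (metis card_length list.set length_Cons list.size(3) numeral_3_eq_3)
  finally show ?thesis .
qed

lemma card4_sub2:
  assumes "S \<subseteq> {a, b, c, d}" "c \<notin> S" "d \<notin> S" shows "card S \<le> 2"
proof -
  have "S \<subseteq> {a, b}" using assms by auto
  then have "card S \<le> card {a, b}" by (rule card_mono[rotated]) auto
  also have "\<dots> \<le> 2" by (simp add: card_insert_if)
  finally show ?thesis .
qed

lemma tdeg_le_3: assumes "p \<in> X" shows "tdeg p \<le> 3"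
proof -
  obtain g d q1 q2 r1 r2 where g: "g \<in> A" "d \<in> A" "g \<noteq> d" and q: "adj g p q1" "adj g p q2" "q1 \<noteq> q2"
    and r: "adj d p r1" "adj d p r2" "r1 \<noteq> r2" using nbrs_at[OF assms] by metis
  let ?S = "{T \<in> Tri. p \<in> T}"
  note sub = Tri_at_subset[OF g q r]
  show ?thesis unfolding tdeg_def
  proof (cases "{p, q1, r1} \<in> Tri \<and> {p, q2, r1} \<in> Tri \<and> {p, q2, r2} \<in> Tri")
    case True
    then have "{p, q1, r2} \<notin> Tri" using not_four_triangles[OF g q r] by auto
    then show "card {T \<in> Tri. p \<in> T} \<le> 3" 
      using card4_sub3[of "{T \<in> Tri. p \<in> T}" "{p, q1, r1}" "{p, q2, r1}" "{p, q2, r2}" "{p, q1, r2}"] sub by auto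
  next
    case False
    have drop: "card ?S \<le> 3" if "x \<notin> Tri" "?S \<subseteq> {a, b, c, x}" for a b c x
      using card4_sub3[OF that(2)] that(1) by simp
    consider "{p, q1, r1} \<notin> Tri" | "{p, q2, r1} \<notin> Tri" | "{p, q2, r2} \<notin> Tri"
      using False by blast
    then show "card ?S \<le> 3"
    proof cases
      case 1 show ?thesis by (rule drop[OF 1, where a="{p, q1, r2}" and b="{p, q2, r1}" and c="{p, q2, r2}"], rule order_trans[OF sub], simp)
    next
      case 2 show ?thesis by (rule drop[OF 2, where a="{p, q1, r1}" and b="{p, q1, r2}" and c="{p, q2, r2}"], rule order_trans[OF sub], simp)
    next
      case 3 show ?thesis by (rule drop[OF 3, where a="{p, q1, r1}" and b="{p, q1, r2}" and c="{p, q2, r1}"], rule order_trans[OF sub], simp)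
    qed
  qed
qed

lemma three_triangles:
  assumes "p \<in> X" "tdeg p \<ge> 3"
  obtains g d q q' r r' where "g \<in> A" "d \<in> A" "g \<noteq> d" "adj g p q" "adj g p q'" "q \<noteq> q'"
    "adj d p r" "adj d p r'" "r \<noteq> r'"
    "{p, q, r} \<in> Tri" "{p, q', r} \<in> Tri" "{p, q', r'} \<in> Tri"
proof -
  obtain g d q1 q2 r1 r2 where g: "g \<in> A" "d \<in> A" "g \<noteq> d" and q: "adj g p q1" "adj g p q2" "q1 \<noteq> q2"
    and r: "adj d p r1" "adj d p r2" "r1 \<noteq> r2" using nbrs_at[OF assms(1)] by metis
  let ?S = "{T \<in> Tri. p \<in> T}"
  note sub = Tri_at_subset[OF g q r]
  have notboth: "a \<in> Tri \<or> b \<in> Tri" if "?S \<subseteq> {c, d, a, b}" for a b c d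
    using card4_sub2[OF that] assms(2) unfolding tdeg_def by auto
  note mk = notboth[OF order_trans[OF sub]]
  have c1: "{p, q1, r1} \<in> Tri \<or> {p, q1, r2} \<in> Tri"
    by (rule mk[where c="{p, q2, r1}" and d="{p, q2, r2}"]) simp
  have c2: "{p, q1, r1} \<in> Tri \<or> {p, q2, r1} \<in> Tri"
    by (rule mk[where c="{p, q1, r2}" and d="{p, q2, r2}"]) simp
  have c3: "{p, q1, r1} \<in> Tri \<or> {p, q2, r2} \<in> Tri"
    by (rule mk[where c="{p, q1, r2}" and d="{p, q2, r1}"]) simp
  have c4: "{p, q1, r2} \<in> Tri \<or> {p, q2, r1} \<in> Tri"
    by (rule mk[where c="{p, q1, r1}" and d="{p, q2, r2}"]) simp
  have c5: "{p, q1, r2} \<in> Tri \<or> {p, q2, r2} \<in> Tri"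
    by (rule mk[where c="{p, q1, r1}" and d="{p, q2, r1}"]) simp
  have c6: "{p, q2, r1} \<in> Tri \<or> {p, q2, r2} \<in> Tri"
    by (rule mk[where c="{p, q1, r1}" and d="{p, q1, r2}"]) simp
  have sym: "q2 \<noteq> q1" "r2 \<noteq> r1" using q r by auto
  \<comment> \<open>By \<open>c1\<close> to \<open>c6\<close> at most one of the four candidates
    fails to be a triangle. Exchanging \<open>q1\<close> with \<open>q2\<close> or \<open>r1\<close>
    with \<open>r2\<close> moves the missing one to the sector of \<open>q\<close> and
    \<open>r'\<close>.\<close>
  note mk1 = that[OF g q r]
  note mk2 = that[OF g q r(2,1) sym(2)]
  note mk3 = that[OF g q(2,1) sym(1) r]
  note mk4 = that[OF g q(2,1) sym(1) r(2,1) sym(2)]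
  show thesis using c1 c2 c3 c4 c5 c6 mk1 mk2 mk3 mk4 by blast
qed

text \<open>The two triangles at \<open>x\<close> share the edge from \<open>x\<close> to
  \<open>p\<close> and nothing more. Expressed by an intersection, this makes \<open>p\<close>
  recoverable from \<open>x\<close>, as an injective charging requires.\<close>

definition linked :: "'p \<Rightarrow> 'p \<Rightarrow> bool" where
  "linked x p \<longleftrightarrow> tdeg x = 2 \<and> p \<noteq> x \<and> \<Inter>{T \<in> Tri. x \<in> T} = {x, p}"

definition twin :: "'p \<Rightarrow> 'p \<Rightarrow> bool" where
  "twin p x \<longleftrightarrow> p \<noteq> x \<and> (\<exists>g\<in>A. \<exists>d\<in>A. g \<noteq> d \<and> p \<in> g \<and> p \<in> d \<and> x \<in> g \<and> x \<in> d)"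

lemma linkedI:
  assumes "tdeg x < 3" "{x, p, u} \<in> Tri" "{x, p, v} \<in> Tri" "u \<noteq> v" "u \<noteq> p" "u \<noteq> x" "p \<noteq> x"
    "v \<noteq> p" "v \<noteq> x"
  shows "linked x p"
proof -
  let ?S = "{T \<in> Tri. x \<in> T}"
  have f: "finite ?S" using finite_Tri by auto
  have ne: "{x, p, u} \<noteq> {x, p, v}" using assms by (auto simp: doubleton_eq_iff)
  have sub: "{{x, p, u}, {x, p, v}} \<subseteq> ?S" using assms by auto
  have c: "card {{x, p, u}, {x, p, v}} = 2" using ne by simp
  have "card ?S \<le> 2" using assms(1) unfolding tdeg_def by simp
  then have eq: "{{x, p, u}, {x, p, v}} = ?S"
    using card_seteq[OF f sub] c by auto
  then have "tdeg x = 2" using c unfolding tdeg_def by simp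
  moreover have "\<Inter>{{x, p, u}, {x, p, v}} = {x, p}" using assms by auto
  ultimately show ?thesis unfolding linked_def using assms(7) eq by simp
qed

text \<open>Only two of the candidates at \<open>x\<close> use \<open>r\<close>, so a third triangle
  must use the other neighbour \<open>s\<close> of \<open>x\<close> along \<open>d\<close>.\<close>

lemma third_triangle:
  assumes "tdeg x \<ge> 3" and g: "g \<in> A" "d \<in> A" "g \<noteq> d" and q: "adj g x q" "adj g x q'" "q \<noteq> q'"
    and r: "adj d x r"
  obtains s where "adj d x s" "s \<noteq> r" "{x, q, s} \<in> Tri \<or> {x, q', s} \<in> Tri"
proof -
  have x: "x \<in> d" "x \<in> X" using adj_inD g r by auto
  obtain s where s: "adj d x s" "s \<noteq> r" using adj_two[OF g(2) x] by metis
  note sub = Tri_at_subset[OF g q r s(1)]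
  have "\<not> ({x, q, s} \<notin> Tri \<and> {x, q', s} \<notin> Tri)"
    using card4_sub2[of "{T \<in> Tri. x \<in> T}" "{x, q, r}" "{x, q', r}" "{x, q, s}" "{x, q', s}"] sub s assms(1)
    unfolding tdeg_def by auto
  then show thesis using that s by auto
qed

text \<open>The sector at \<open>p\<close> that may be empty is the one of \<open>q\<close> and
  \<open>r'\<close>; the edges from \<open>p\<close> to \<open>r\<close> and to \<open>q'\<close>
  are shared by two triangles each. If \<open>r\<close> or \<open>q'\<close> lies in fewer than
  three triangles, it is linked to \<open>p\<close>. Otherwise the further triangles at
  \<open>r\<close> and at \<open>q'\<close> both reach the second crossing \<open>s\<close> of
  \<open>g\<close> and \<open>d\<close>, which then takes the charge.\<close>

lemma charge:
  assumes "p \<in> X" "tdeg p = 3"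
  shows "\<exists>x\<in>X. tdeg x \<le> 2 \<and> (linked x p \<or> twin p x \<and> (\<forall>y. \<not> linked x y))"
proof -
  obtain g d q q' r r' where g: "g \<in> A" "d \<in> A" "g \<noteq> d" and q: "adj g p q" "adj g p q'" "q \<noteq> q'"
    and r: "adj d p r" "adj d p r'" "r \<noteq> r'" and
    T: "{p, q, r} \<in> Tri" "{p, q', r} \<in> Tri" "{p, q', r'} \<in> Tri"
    by (rule three_triangles[of p]) (use assms in auto)
  obtain a where a: "a \<in> A" "a \<noteq> g" "a \<noteq> d" "adj a q r" "adj a q' r" "q \<in> a" "r \<in> a" "q' \<in> a"
    and nin: "p \<notin> a" "q \<notin> d" "q' \<notin> d" "r \<notin> g"
    using two_triangles[OF T(1,2) g q(1,2) r(1)] by metis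
  obtain b where b: "b \<in> A" "b \<noteq> g" "b \<noteq> d" "adj b q' r'" "r' \<in> b" "q' \<in> b"
    using Tri_third[OF T(3) g q(2) r(2)] by metis
  have inX: "p \<in> g" "p \<in> d" "q \<in> g" "q' \<in> g" "r \<in> d" "r' \<in> d" "q \<in> X" "q' \<in> X" "r \<in> X" "r' \<in> X"
    "p \<noteq> q" "p \<noteq> q'" "p \<noteq> r" "p \<noteq> r'"
    using adj_inD g q r by metis+
  have "b = a" using two_curves[of g a q' b] a b g inX by auto
  note b = b[unfolded this]
  have ne: "q \<noteq> r" "q' \<noteq> r" "q' \<noteq> r'" using nin inX by auto
  show ?thesis
  proof (cases "tdeg r < 3")
    case True
    have "linked r p" by (rule linkedI[of r p q q']) (use True T ne inX q in \<open>auto simp: insert_commute\<close>)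
    then show ?thesis using True inX by (intro bexI[of _ r]) auto
  next
    case r3: False
    show ?thesis
    proof (cases "tdeg q' < 3")
      case True
      have "linked q' p" by (rule linkedI[of q' p r r']) (use True T ne inX r in \<open>auto simp: insert_commute\<close>)
      then show ?thesis using True inX by (intro bexI[of _ q']) auto
    next
      case q3: False
      obtain s where s: "adj d r s" "s \<noteq> p" "{r, q, s} \<in> Tri \<or> {r, q', s} \<in> Tri"
        using third_triangle[of r a d q q' p] r3 a g q r adj_sym by (metis not_less)
      obtain s' where s': "adj g q' s'" "s' \<noteq> p" "{q', r, s'} \<in> Tri \<or> {q', r', s'} \<in> Tri"
        using third_triangle[of q' a g r r' p] q3 a b g q r adj_sym by (metis not_less)
      \<comment> \<open>The third side of the new triangle at \<open>r\<close> leaves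
        \<open>q\<close> or \<open>q'\<close> along a curve other than \<open>a\<close>, and there
        this can only be \<open>g\<close>.\<close>
      have sg: "s \<in> g \<and> (adj g q s \<and> {r, q, s} \<in> Tri \<or> adj g q' s \<and> {r, q', s} \<in> Tri)"
      proof -
        have "adj g y s \<and> s \<in> g" if y: "{r, y, s} \<in> Tri" "adj a r y" "y \<in> g" "y \<in> a" for y
        proof -
          obtain h where "h \<in> A" "h \<noteq> a" "h \<noteq> d" "adj h y s" 
            using Tri_third[OF y(1) a(1) g(2) a(3) y(2) s(1)] by metis
          moreover have "h = g" using two_curves[of g a y h] calculation y a g adj_inD by metis
          ultimately show ?thesis using adj_inD g by metis
        qed
        from this[of q] this[of q'] show ?thesis using s(3) a inX adj_sym by metis
      qed
      have sd: "s' \<in> d \<and> (adj d r s' \<and> {q', r, s'} \<in> Tri \<or> adj d r' s' \<and> {q', r', s'} \<in> Tri)"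
      proof -
        have "adj d y s' \<and> s' \<in> d" if y: "{q', y, s'} \<in> Tri" "adj a q' y" "y \<in> d" "y \<in> a" for y
        proof -
          obtain h where "h \<in> A" "h \<noteq> a" "h \<noteq> g" "adj h y s'" 
            using Tri_third[OF y(1) a(1) g(1) a(2) y(2) s'(1)] by metis
          moreover have "h = d" using two_curves[of d a y h] calculation y a g adj_inD by metis
          ultimately show ?thesis using adj_inD g by metis
        qed
        from this[of r] this[of r'] show ?thesis using s'(3) a b inX by metis
      qed
      have sdg: "s \<in> d" "s \<in> X" "s' \<in> g" using adj_inD g s s' by metis+
      \<comment> \<open>Both are crossings of \<open>g\<close> and \<open>d\<close> different from
        \<open>p\<close>.\<close>
      have "s' = s" using meet_twice[of g d p s' s] g inX sg sd sdg s s' by metis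
      note s' = s'[unfolded this] and sd = sd[unfolded this]
      \<comment> \<open>Otherwise \<open>g\<close> would close up as \<open>p\<close>,
        \<open>q\<close>, \<open>s\<close>, \<open>q'\<close>.\<close>
      have "\<not> adj g q s" using no_four_cycle[of g q p q' s] g q s s' adj_sym by metis
      then have T5: "{r, q', s} \<in> Tri" using sg by auto
      then have T5': "{s, q', r} \<in> Tri" by (simp add: insert_commute)
      obtain y where y: "adj g s y" "y \<noteq> q'" using adj_two[of g s] g sg sdg by metis
      obtain z where z: "adj d s z" "z \<noteq> r" using adj_two[of d s] g sg sdg by metis
      have adjs: "adj g s q'" "adj d s r" using s' s adj_sym by auto
      \<comment> \<open>This triangle would have its third side on \<open>a\<close>, forcing
        \<open>z = r'\<close>; then \<open>d\<close> would close up as \<open>p\<close>,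
        \<open>r\<close>, \<open>s\<close>, \<open>r'\<close>.\<close>
      have n1: "{s, q', z} \<notin> Tri"
      proof
        assume T6: "{s, q', z} \<in> Tri"
        have T5'': "{s, r, q'} \<in> Tri" "{s, z, q'} \<in> Tri" using T5' T6 by (simp_all add: insert_commute)
        obtain h where h: "h \<in> A" "h \<noteq> d" "h \<noteq> g" "adj h r q'" "adj h z q'" "q' \<in> h"
          using two_triangles[OF T5'' g(2,1) g(3)[symmetric] adjs(2) z(1) adjs(1)] by metis
        have "h = a" using two_curves[of g a q' h] h a g inX by auto
        then have "z = r'" using adj_third[of a q' r r' z] a b r h z adj_sym by metis
        then show False using no_four_cycle[of d p r s r'] g r s z adj_sym by metis
      qed
      \<comment> \<open>The third side would again lie on \<open>a\<close>, forcing
        \<open>y = q\<close>, although \<open>q\<close> and \<open>s\<close> are not consecutive on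
        \<open>g\<close>.\<close>
      have n2: "{s, y, r} \<notin> Tri"
      proof
        assume T6: "{s, y, r} \<in> Tri"
        obtain h where h: "h \<in> A" "h \<noteq> g" "h \<noteq> d" "adj h q' r" "adj h y r" "r \<in> h"
          using two_triangles[OF T5' T6 g adjs(1) y(1) adjs(2)] by metis
        have "h = a" using two_curves[of d a r h] h a g inX by auto
        then have "y = q" using adj_third[of a r q q' y] a q h y adj_sym by metis
        then show False using \<open>\<not> adj g q s\<close> y adj_sym by metis
      qed
      let ?S = "{T \<in> Tri. s \<in> T}"
      have "?S \<subseteq> {{s, q', r}, {s, q', z}, {s, y, r}, {s, y, z}}"
        using Tri_at_subset[OF g adjs(1) y(1) y(2)[symmetric] adjs(2) z(1) z(2)[symmetric]] .
      then have sub: "?S \<subseteq> {{s, q', r}, {s, y, z}}" using n1 n2 by auto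
      have le2: "tdeg s \<le> 2" unfolding tdeg_def 
        by (rule card4_sub2[of _ "{s, q', r}" "{s, y, z}" "{s, q', z}" "{s, y, r}"]) (use sub n1 n2 in auto)
      \<comment> \<open>Only two opposite sectors at \<open>s\<close> remain, and triangles in them
        have no common corner besides \<open>s\<close>.\<close>
      have nl: "\<not> linked s x" for x
      proof
        assume l: "linked s x"
        then have c: "card ?S = 2" unfolding linked_def tdeg_def by auto
        have card2: "card {{s, q', r}, {s, y, z}} \<le> 2" by (simp add: card_insert_if)
        have S: "?S = {{s, q', r}, {s, y, z}}" using card_seteq[OF _ sub] card2 c by auto
        then have T7: "{s, y, z} \<in> Tri" by auto
        obtain h where h: "y \<in> g" "z \<in> d" "y \<notin> d" "z \<notin> g" 
          using Tri_third[OF T7 g y(1) z(1)] by metis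
        have "y \<noteq> r" "z \<noteq> q'" using h inX by auto
        then have "{s, q', r} \<inter> {s, y, z} = {s}" using y(2) z(2) by blast
        moreover have "\<Inter>?S = {s, q', r} \<inter> {s, y, z}" unfolding S by simp
        ultimately have "{s} = {s, x}" "x \<noteq> s" using l unfolding linked_def by auto
        then show False by blast
      qed
      have "twin p s" unfolding twin_def using g inX sg sdg s by auto
      then show ?thesis using le2 nl sdg by auto
    qed
  qed
qed

text \<open>A linked crossing determines the crossing charged to it by the common edge of its two
  triangles; one that is not linked is charged by its twin, which is unique because two curves meet
  in at most two points.\<close>

lemma card_three_le:
  "card {p \<in> X. tdeg p = 3} \<le> card {p \<in> X. tdeg p \<le> 2}"
proof -
  obtain f where f: "\<And>p. p \<in> X \<Longrightarrow> tdeg p = 3 \<Longrightarrow> f p \<in> X \<and> tdeg (f p) \<le> 2 \<and>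
      (linked (f p) p \<or> twin p (f p) \<and> (\<forall>y. \<not> linked (f p) y))"
    using charge by metis
  have "inj_on f {p \<in> X. tdeg p = 3}"
  proof (rule inj_onI)
    fix p p' assume p: "p \<in> {p \<in> X. tdeg p = 3}" "p' \<in> {p \<in> X. tdeg p = 3}" and eq: "f p = f p'"
    have fp: "linked (f p) p \<or> twin p (f p) \<and> (\<forall>y. \<not> linked (f p) y)"
      "linked (f p) p' \<or> twin p' (f p) \<and> (\<forall>y. \<not> linked (f p) y)" using f[of p] f[of p'] p eq by auto
    then consider "linked (f p) p" "linked (f p) p'" | "twin p (f p)" "twin p' (f p)" by auto
    then show "p = p'"
    proof cases
      case 1 then show ?thesis unfolding linked_def by (auto simp: doubleton_eq_iff)
    next
      case 2
      then obtain g d g' d' where g: "g\<in>A" "d\<in>A" "g \<noteq> d" "p \<in> g" "p \<in> d" "f p \<in> g" "f p \<in> d" "p \<noteq> f p"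
        and g': "g'\<in>A" "d'\<in>A" "g' \<noteq> d'" "p' \<in> g'" "p' \<in> d'" "f p \<in> g'" "f p \<in> d'" "p' \<noteq> f p"
        unfolding twin_def by auto
      have "g' = g \<or> g' = d" "d' = g \<or> d' = d" using two_curves g g' by metis+
      then have "p' \<in> g" "p' \<in> d" using g' by auto
      then show ?thesis using meet_twice[of g d "f p" p p'] g g' by auto
    qed
  qed
  moreover have "f ` {p \<in> X. tdeg p = 3} \<subseteq> {p \<in> X. tdeg p \<le> 2}" using f by auto
  ultimately show ?thesis using finite_X by (intro card_inj_on_le[of f]) auto
qed

lemma card_Tri_le: "6 * card Tri \<le> 5 * card X"
proof -
  let ?P = "{p \<in> X. tdeg p = 3}" and ?Q = "{p \<in> X. tdeg p \<le> 2}"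
  have X: "X = ?P \<union> ?Q" "?P \<inter> ?Q = {}" using tdeg_le_3 by force+
  have fin: "finite ?P" "finite ?Q" using finite_X by auto
  have "3 * card Tri = (\<Sum>p\<in>X. tdeg p)"
  proof -
    have "(\<Sum>p\<in>X. tdeg p) = (\<Sum>p\<in>X. card {T \<in> Tri. p \<in> T})" by (simp add: tdeg_def)
    also have "\<dots> = (\<Sum>T\<in>Tri. card {p \<in> X. p \<in> T})"
      by (rule sum_multicount_gen) (auto simp: finite_X finite_Tri)
    also have "\<dots> = (\<Sum>T\<in>Tri. 3)"
    proof (rule sum.cong[OF refl])
      fix T assume T: "T \<in> Tri"
      then have "{p \<in> X. p \<in> T} = T" using Tri_sub by auto
      then show "card {p \<in> X. p \<in> T} = 3" using card_Tri T by simp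
    qed
    finally show ?thesis by simp
  qed
  also have "\<dots> = (\<Sum>p\<in>?P \<union> ?Q. tdeg p)" by (rule sum.cong[OF X(1) refl])
  also have "\<dots> = (\<Sum>p\<in>?P. tdeg p) + (\<Sum>p\<in>?Q. tdeg p)"
    by (rule sum.union_disjoint[OF fin X(2)])
  also have "\<dots> \<le> (\<Sum>p\<in>?P. 3) + (\<Sum>p\<in>?Q. 2)"
    by (intro add_mono sum_mono) auto
  also have "\<dots> = 3 * card ?P + 2 * card ?Q" by simp
  finally have 1: "3 * card Tri \<le> 3 * card ?P + 2 * card ?Q" .
  have "card X = card (?P \<union> ?Q)" by (rule arg_cong[OF X(1)])
  then have 2: "card X = card ?P + card ?Q" by (simp only: card_Un_disjoint[OF fin X(2)])
  \<comment> \<open>Doubling the first bound gives \<open>6 * card ?P + 4 * card ?Q\<close>, and the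
    charging exchanges one \<open>card ?P\<close> for one \<open>card ?Q\<close>, which leaves five
    of each.\<close>
  show ?thesis using 1 2 card_three_le by linarith
qed

end

section \<open>The Jordan curve theorem and Janiszewski's theorem on the sphere\<close>

lemma compact_S2: "compact S2"
  and connected_S2: "connected S2"
  and locally_connected_S2: "locally connected S2"
  by (auto simp: S2_def connected_sphere locally_connected_sphere)

lemma islimpt_S2:
  assumes "a \<in> S2" shows "a islimpt S2"
proof (rule connected_imp_perfect[OF connected_S2 assms])
  fix x
  have "a \<noteq> 0" using assms by (auto simp: S2_def)
  then have "2 *\<^sub>R a \<noteq> 0" by simp
  then have "a \<noteq> - a" unfolding eq_neg_iff_add_eq_0 scaleR_2 .
  moreover have "- a \<in> S2" using assms by (simp add: S2_def)
  ultimately show "S2 \<noteq> {x}" using assms by (metis singletonD)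
qed

lemma openin_S2_Diff: "closed K \<Longrightarrow> openin (top_of_set S2) (S2 - K)"
  by (metis Diff_eq open_Compl openin_open_Int)

text \<open>Supplies centres of projection: a nonempty relatively open part of the sphere is
  infinite, so finitely many points can be avoided.\<close>

lemma exists_S2_point:
  assumes "closed K" "\<not> S2 \<subseteq> K" "finite F"
  obtains z where "z \<in> S2" "z \<notin> K" "z \<notin> F"
proof -
  obtain a where a: "a \<in> S2 - K" using assms by auto
  then have "infinite (S2 - K)"
    using infinite_openin[OF openin_S2_Diff[OF assms(1)] a] islimpt_S2 by auto
  then have "infinite (S2 - K - F)" using assms(3) by (rule Diff_infinite_finite[rotated])
  then show thesis using that by (metis Diff_iff finite.emptyI ex_in_conv)
qed

lemma S2_punctured:
  assumes "z \<in> S2"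
  obtains f h where "homeomorphism (S2 - {z}) (UNIV :: complex set) f h"
proof -
  have "(S2 - {z}) homeomorphic (UNIV :: complex set)"
    unfolding S2_def by (rule homeomorphic_punctured_sphere_affine) (use assms in \<open>auto simp: S2_def\<close>)
  then show thesis using that unfolding homeomorphic_def by blast
qed

text \<open>Projection from a point outside \<open>U\<close> makes \<open>U\<close> open and
  connected in the plane, where deleting a point keeps it connected.\<close>

lemma connected_S2_delete:
  assumes U: "openin (top_of_set S2) U" "connected U" "U \<noteq> S2"
  shows "connected (U - {x})"
proof (cases "x \<in> U")
  case True
  have sub: "U \<subseteq> S2" using U openin_imp_subset by blast
  then obtain y where y: "y \<in> S2" "y \<notin> U" using U by blast
  obtain f h where fh: "homeomorphism (S2 - {y}) (UNIV :: complex set) f h" using S2_punctured y by blast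
  have U': "U \<subseteq> S2 - {y}" using sub y by auto
  have "openin (top_of_set (S2 - {y})) U"
    using U(1) U' openin_subset_trans by (metis Diff_subset)
  then have "openin (top_of_set UNIV) (f ` U)" using homeomorphism_imp_open_map[OF fh] by blast
  then have op: "open (f ` U)" by simp
  have "connected (f ` U)"
    by (rule connected_continuous_image) (use fh U' U(2) in \<open>auto simp: homeomorphism_def intro: continuous_on_subset\<close>)
  then have c: "connected (f ` U - {f x})" using connected_open_delete[OF op] by simp
  have hf: "h (f u) = u" if "u \<in> U" for u using homeomorphism_apply1[OF fh] that U' by auto
  have "U - {x} = h ` (f ` U - {f x})" 
  proof
    show "U - {x} \<subseteq> h ` (f ` U - {f x})"
    proof
      fix u assume u: "u \<in> U - {x}"
      then have "f u \<noteq> f x" using hf[of u] hf[of x] True by auto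
      then show "u \<in> h ` (f ` U - {f x})" using hf[of u] u by (intro image_eqI[of _ _ "f u"]) auto
    qed
    show "h ` (f ` U - {f x}) \<subseteq> U - {x}" using hf by auto
  qed
  moreover have "connected (h ` (f ` U - {f x}))"
    by (rule connected_continuous_image[OF _ c]) (use fh in \<open>auto simp: homeomorphism_def intro: continuous_on_subset\<close>)
  ultimately show ?thesis by simp
next
  case False
  then show ?thesis using U by simp
qed

text \<open>Meant for \<open>z\<close> as a centre of projection: taking it away does not change
  which other points \<open>K\<close> separates. Since \<open>K\<close> meets the sphere, the
  component of \<open>a\<close> is a proper subset of it.\<close>

lemma connected_component_S2_delete:
  assumes K: "closed K" "K \<inter> S2 \<noteq> {}" and cc: "connected_component (S2 - K) a b" and z: "z \<noteq> a" "z \<noteq> b"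
  shows "connected_component (S2 - K - {z}) a b"
proof -
  let ?U = "connected_component_set (S2 - K) a"
  have "locally connected (S2 - K)"
    using locally_open_subset[OF locally_connected_S2 openin_S2_Diff[OF K(1)]] .
  then have "openin (top_of_set (S2 - K)) ?U"
    by (rule openin_connected_component_locally_connected)
  then have op: "openin (top_of_set S2) ?U" using openin_S2_Diff[OF K(1)] openin_trans by blast
  have sub: "?U \<subseteq> S2 - K" by (rule connected_component_subset)
  then have "?U \<noteq> S2" using K(2) by auto
  then have c: "connected (?U - {z})" using connected_S2_delete[OF op] by simp
  have "a \<in> S2 - K" using connected_component_in[OF cc] by auto
  then have "a \<in> ?U - {z}" "b \<in> ?U - {z}" using cc z by (auto simp: connected_component_refl)
  moreover have "?U - {z} \<subseteq> S2 - K - {z}" using sub by auto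
  ultimately have "\<exists>W. connected W \<and> W \<subseteq> S2 - K - {z} \<and> a \<in> W \<and> b \<in> W" using c by blast
  then show ?thesis unfolding connected_component_def .
qed

text \<open>Separation by \<open>K\<close> reads the same before and after projection from
  \<open>z\<close>. A connecting set on the sphere may run through \<open>z\<close> and is first
  replaced by one that avoids it.\<close>

lemma connected_component_S2_plane:
  assumes K: "closed K" "K \<subseteq> S2" "K \<noteq> {}" "z \<in> S2 - K" 
    and fh: "homeomorphism (S2 - {z}) (UNIV :: complex set) f h"
    and ab: "a \<in> S2 - K - {z}" "b \<in> S2 - K - {z}"
  shows "connected_component (S2 - K) a b \<longleftrightarrow> connected_component (- f ` K) (f a) (f b)"
proof
  note contf = homeomorphism_cont1[OF fh] and conth = homeomorphism_cont2[OF fh]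
    and hf = homeomorphism_apply1[OF fh] and fhh = homeomorphism_apply2[OF fh]
    and him = homeomorphism_image2[OF fh]
  { assume cc: "connected_component (S2 - K) a b"
    have "K \<inter> S2 \<noteq> {}" using K by auto
    then obtain W where W: "connected W" "W \<subseteq> S2 - K - {z}" "a \<in> W" "b \<in> W"
      using connected_component_S2_delete[OF K(1) _ cc, of z] ab unfolding connected_component_def by auto
    have "connected (f ` W)"
      by (rule connected_continuous_image[OF continuous_on_subset[OF contf] W(1)]) (use W in auto)
    moreover have "f ` W \<subseteq> - f ` K"
    proof
      fix y assume "y \<in> f ` W"
      then obtain w where w: "w \<in> W" "y = f w" by auto
      have "f w \<noteq> f k" if "k \<in> K" for k
      proof
        assume "f w = f k"
        then have "w = k" using hf[of w] hf[of k] w W K that by auto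
        then show False using w W that by auto
      qed
      then show "y \<in> - f ` K" using w by auto
    qed
    ultimately show "connected_component (- f ` K) (f a) (f b)" unfolding connected_component_def
      using W by blast }
  { assume "connected_component (- f ` K) (f a) (f b)"
    then obtain W where W: "connected W" "W \<subseteq> - f ` K" "f a \<in> W" "f b \<in> W"
      unfolding connected_component_def by auto
    have "connected (h ` W)"
      by (rule connected_continuous_image[OF continuous_on_subset[OF conth] W(1)]) auto
    moreover have "h ` W \<subseteq> S2 - K"
    proof
      fix y assume "y \<in> h ` W"
      then obtain w where w: "w \<in> W" "y = h w" by auto
      have "y \<in> S2 - {z}" using him w by auto
      moreover have "y \<notin> K" using w W(2) fhh[of w] by (metis ComplD UNIV_I image_eqI subsetD)
      ultimately show "y \<in> S2 - K" by auto
    qed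
    moreover have "a \<in> h ` W" "b \<in> h ` W" using W hf[of a] hf[of b] ab by (metis Diff_iff imageI singletonD)+
    ultimately show "connected_component (S2 - K) a b" unfolding connected_component_def by blast }
qed

text \<open>The planar theorem, transported by projection from a point off
  \<open>S \<union> T\<close> and different from \<open>a\<close> and \<open>b\<close>. Such a point
  exists because \<open>a\<close> shows that the union is not the whole sphere.\<close>

theorem Janiszewski_S2:
  assumes S: "closed S" "S \<subseteq> S2" "S \<noteq> {}" and T: "closed T" "T \<subseteq> S2" "T \<noteq> {}" and con: "connected (S \<inter> T)"
    and ccS: "connected_component (S2 - S) a b" and ccT: "connected_component (S2 - T) a b"
  shows "connected_component (S2 - (S \<union> T)) a b"
proof -
  have ab: "a \<in> S2 - (S \<union> T)" "b \<in> S2 - (S \<union> T)" using connected_component_in ccS ccT by blast+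
  obtain z where z: "z \<in> S2" "z \<notin> S \<union> T" "z \<notin> {a, b}"
    by (rule exists_S2_point[of "S \<union> T" "{a, b}"]) (use S T ab in auto)
  obtain f h where fh: "homeomorphism (S2 - {z}) (UNIV :: complex set) f h" using S2_punctured z by blast
  note contf = homeomorphism_cont1[OF fh] and hf = homeomorphism_apply1[OF fh] 
  have cpt: "compact (f ` K)" if "closed K" "K \<subseteq> S2" "z \<notin> K" for K
  proof -
    have "compact K" using that compact_S2 by (metis compact_Int_closed inf.absorb2)
    then show ?thesis using that contf
      by (intro compact_continuous_image) (auto intro: continuous_on_subset)
  qed
  have "connected_component (- (f ` S \<union> f ` T)) (f a) (f b)"
  proof (rule Janiszewski)
    show "compact (f ` S)" using cpt S z by auto
    show "closed (f ` T)" using cpt T z by (auto intro: compact_imp_closed)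
    have "f ` S \<inter> f ` T = f ` (S \<inter> T)"
    proof -
      have "inj_on f (S \<union> T)" by (rule inj_on_inverseI[of _ h]) (use hf S T z in auto)
      then show ?thesis by (metis inj_on_image_Int sup_ge1 sup_ge2)
    qed
    moreover have "connected (f ` (S \<inter> T))"
      by (rule connected_continuous_image[OF continuous_on_subset[OF contf] con]) (use S T z in auto)
    ultimately show "connected (f ` S \<inter> f ` T)" by simp
    show "connected_component (- f ` S) (f a) (f b)"
      using connected_component_S2_plane[OF S, of z f h a b] fh ccS z ab by auto
    show "connected_component (- f ` T) (f a) (f b)"
      using connected_component_S2_plane[OF T, of z f h a b] fh ccT z ab by auto
  qed
  then show ?thesis
    using connected_component_S2_plane[of "S \<union> T" z f h a b] fh z ab S T by (auto simp: image_Un)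
qed

text \<open>A closed simple path is the form in which a curve can be cut at marked points and in
  which the planar Jordan curve theorem applies.\<close>

lemma pseudocircle_iff:
  "pseudocircle g \<longleftrightarrow> g \<subseteq> S2 \<and> (\<exists>c. simple_path c \<and> pathfinish c = pathstart c \<and> path_image c = g)"
proof -
  have "(\<exists>c. simple_path c \<and> pathfinish c = pathstart c \<and> path_image c = g)"
    if hom: "g homeomorphic sphere (0::complex) 1"
  proof -
    obtain f h where fh: "homeomorphism (sphere (0::complex) 1) g f h"
      using hom unfolding homeomorphic_sym[of g] unfolding homeomorphic_def by blast
    have "simple_path (f \<circ> circlepath 0 1)"
      by (rule simple_path_continuous_image)
        (use homeomorphism_cont1[OF fh] homeomorphism_apply1[OF fh] in
          \<open>auto simp: simple_path_circlepath intro: inj_on_inverseI[of _ h]\<close>)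
    moreover have "pathfinish (f \<circ> circlepath 0 1) = pathstart (f \<circ> circlepath 0 1)"
      by (simp add: pathfinish_compose pathstart_compose)
    moreover have "path_image (f \<circ> circlepath 0 1) = g"
      using fh by (simp add: path_image_compose homeomorphism_def)
    ultimately show ?thesis by blast
  qed
  then show ?thesis unfolding pseudocircle_def 
    using homeomorphic_simple_path_image_circle[where a=0 and r=1] by fastforce
qed

text \<open>The sphere is simply connected and the circle is not. This leaves a point off the curve
  to project from.\<close>

lemma pseudocircle_not_S2: assumes "pseudocircle g" shows "\<not> S2 \<subseteq> g"
proof
  assume "S2 \<subseteq> g"
  then have "sphere (0::real^3) 1 homeomorphic sphere (0::complex) 1"
    using assms unfolding pseudocircle_def S2_def by (metis subset_antisym)
  moreover have "simply_connected (sphere (0::real^3) 1)" by (simp add: simply_connected_sphere)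
  ultimately have "simply_connected (sphere (0::complex) 1)" 
    using homeomorphic_simply_connected_eq by blast
  then show False by (simp add: simply_connected_sphere_eq)
qed

lemma compact_pseudocircle: "pseudocircle g \<Longrightarrow> compact g"
  unfolding pseudocircle_iff by (metis compact_simple_path_image)

text \<open>Transported from the plane by projection from a point \<open>z\<close> off
  \<open>g\<close>. That both sides accumulate at all of \<open>g\<close> is what later places cells
  along edges.\<close>

theorem Jordan_S2:
  assumes "pseudocircle g"
  obtains C D where "C \<noteq> D" "components (S2 - g) = {C, D}" "g \<subseteq> closure C" "g \<subseteq> closure D"
proof -
  obtain c where g: "g \<subseteq> S2" and c: "simple_path c" "pathfinish c = pathstart c" "path_image c = g"
    using assms unfolding pseudocircle_iff by blast
  have cl: "closed g" using compact_pseudocircle[OF assms] compact_imp_closed by blast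
  have ne: "g \<noteq> {}" using c path_image_nonempty by blast
  obtain z where z: "z \<in> S2" "z \<notin> g" using exists_S2_point[OF cl pseudocircle_not_S2[OF assms], of "{}"] by auto
  obtain f h where fh: "homeomorphism (S2 - {z}) (UNIV :: complex set) f h" using S2_punctured z by blast
  note contf = homeomorphism_cont1[OF fh] and hf = homeomorphism_apply1[OF fh] and fhh = homeomorphism_apply2[OF fh]
    and conth = homeomorphism_cont2[OF fh] and him = homeomorphism_image2[OF fh]
  have gz: "g \<subseteq> S2 - {z}" using g z by auto
  have "simple_path (f \<circ> c)"
    by (rule simple_path_continuous_image[OF c(1)])
      (use c gz contf hf in \<open>auto intro: continuous_on_subset inj_on_inverseI[of _ h]\<close>)
  moreover have "pathfinish (f \<circ> c) = pathstart (f \<circ> c)" using c by (simp add: pathfinish_compose pathstart_compose)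
  ultimately obtain I J where IJ: "I \<noteq> {}" "open I" "connected I" "J \<noteq> {}" "open J" "connected J"
      "I \<inter> J = {}" "I \<union> J = - (f ` g)" "frontier I = f ` g" "frontier J = f ` g"
    using Jordan_inside_outside[of "f \<circ> c"] unfolding path_image_compose c(3) by metis
  obtain u v where u: "u \<in> I" and v: "v \<in> J" using IJ by auto
  have hout: "h w \<in> S2 - g - {z}" if "w \<in> I \<union> J" for w
  proof -
    have "h w \<in> S2 - {z}" using him by auto
    moreover have "h w \<notin> g" using that unfolding IJ(8) by (metis ComplD fhh UNIV_I image_eqI)
    ultimately show ?thesis by auto
  qed
  have plane: "connected_component (S2 - g) a b \<longleftrightarrow> connected_component (- f ` g) (f a) (f b)"
    if "a \<in> S2 - g - {z}" "b \<in> S2 - g - {z}" for a b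
    using connected_component_S2_plane[OF cl g ne _ fh that] z by auto
  let ?C = "connected_component_set (S2 - g) (h u)" and ?D = "connected_component_set (S2 - g) (h v)"
  have inC: "x \<in> ?C" if "x \<in> S2 - {z}" "f x \<in> I" for x
  proof -
    have "connected_component (- f ` g) (f (h u)) (f x)"
      unfolding connected_component_def using IJ u that fhh[of u] by (intro exI[of _ I]) auto
    moreover have "x \<notin> g" using that IJ(8) by auto
    ultimately show ?thesis using plane[of "h u" x] hout[of u] u that by auto
  qed
  have inD: "x \<in> ?D" if "x \<in> S2 - {z}" "f x \<in> J" for x
  proof -
    have "connected_component (- f ` g) (f (h v)) (f x)"
      unfolding connected_component_def using IJ v that fhh[of v] by (intro exI[of _ J]) auto
    moreover have "x \<notin> g" using that IJ(8) by auto
    ultimately show ?thesis using plane[of "h v" x] hout[of v] v that by auto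
  qed
  have neq: "\<not> connected_component (S2 - g) (h u) (h v)"
  proof
    assume "connected_component (S2 - g) (h u) (h v)"
    then have "connected_component (- f ` g) u v" using plane[of "h u" "h v"] hout u v fhh by auto
    then obtain W where W: "connected W" "W \<subseteq> I \<union> J" "u \<in> W" "v \<in> W" 
      unfolding connected_component_def IJ(8)[symmetric] by auto
    show False using connectedD[OF W(1), of I J] IJ W u v by auto
  qed
  have cover: "x \<in> ?C \<or> x \<in> ?D" if "x \<in> S2 - g" "x \<noteq> z" for x
  proof -
    have "f x \<notin> f ` g" using that hf gz by (metis Diff_iff imageE singletonD subsetD)
    then have "f x \<in> I \<or> f x \<in> J" using IJ(8) by auto
    then show ?thesis using inC inD that by auto
  qed
  \<comment> \<open>The projection says nothing about its own centre. But the component of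
    \<open>z\<close> is open in the sphere, so it contains another point, whose side is
    known.\<close>
  have zcover: "z \<in> ?C \<or> z \<in> ?D"
  proof -
    let ?Z = "connected_component_set (S2 - g) z"
    have "locally connected (S2 - g)"
      using locally_open_subset[OF locally_connected_S2 openin_S2_Diff[OF cl]] .
    then have "openin (top_of_set (S2 - g)) ?Z"
      by (rule openin_connected_component_locally_connected)
    then have op: "openin (top_of_set S2) ?Z" using openin_S2_Diff[OF cl] openin_trans by blast
    have "z \<in> ?Z" using z by (simp add: connected_component_refl)
    then have "infinite ?Z" using infinite_openin[OF op] islimpt_S2[OF z(1)] by blast
    then obtain x where x: "x \<in> ?Z" "x \<noteq> z" by (metis finite.emptyI finite_insert finite_subset insertCI subsetI)
    then have "x \<in> ?C \<or> x \<in> ?D" using cover connected_component_subset by blast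
    then show ?thesis using x by (metis connected_component_sym connected_component_trans mem_Collect_eq)
  qed
  have comps: "components (S2 - g) = {?C, ?D}"
  proof -
    have "?C \<in> components (S2 - g)" "?D \<in> components (S2 - g)"
      using hout u v by (auto intro!: componentsI)
    moreover have "K = ?C \<or> K = ?D" if K: "K \<in> components (S2 - g)" for K
    proof -
      obtain x where x: "x \<in> S2 - g" "K = connected_component_set (S2 - g) x" using K components_iff by metis
      have "x \<in> ?C \<or> x \<in> ?D" using cover zcover x by auto
      then show ?thesis using x connected_component_eq by metis
    qed
    ultimately show ?thesis by auto
  qed
  \<comment> \<open>The inverse projection \<open>h\<close> is continuous on the plane and maps the
    planar frontier back onto \<open>g\<close>.\<close>
  have clos: "g \<subseteq> closure K" if K: "\<And>x. x \<in> S2 - {z} \<Longrightarrow> f x \<in> O' \<Longrightarrow> x \<in> K" and fr: "frontier O' = f ` g" for K O'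
  proof
    fix x assume x: "x \<in> g"
    then have "f x \<in> closure O'" using fr by (auto simp: frontier_def)
    then have "h (f x) \<in> h ` closure O'" by blast
    also have "\<dots> \<subseteq> closure (h ` O')"
      by (rule image_closure_subset) (use conth closure_subset[of "h ` O'"] in \<open>auto intro: continuous_on_subset\<close>)
    also have "\<dots> \<subseteq> closure K"
    proof (rule closure_mono, rule image_subsetI)
      fix w assume "w \<in> O'"
      then show "h w \<in> K" using K[of "h w"] him fhh[of w] by auto
    qed
    finally have "h (f x) \<in> closure K" .
    moreover have "x \<in> S2 - {z}" using gz x by blast
    ultimately show "x \<in> closure K" using hf by simp
  qed
  show thesis
  proof (rule that[OF _ comps])
    show "?C \<noteq> ?D" using neq hout v by (metis (no_types, lifting) Diff_iff UnI2 connected_component_refl_eq mem_Collect_eq)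
    show "g \<subseteq> closure ?C" using clos[of I ?C] inC IJ by blast
    show "g \<subseteq> closure ?D" using clos[of J ?D] inD IJ by blast
  qed
qed

section \<open>Edges of a curve with finitely many marked points\<close>

definition edges :: "'a::real_normed_vector set \<Rightarrow> 'a set \<Rightarrow> 'a set set" where
  "edges g X = components (g - X)"

text \<open>With three marks the two edges at a mark lead to different marks, so an edge is
  determined by its two ends.\<close>

locale marked_curve =
  fixes g X :: "'a::real_normed_vector set"
  assumes curve: "\<exists>c. simple_path c \<and> pathfinish c = pathstart c \<and> path_image c = g"
    and X_sub: "X \<subseteq> g" and finite_X: "finite X" and card_X: "card X \<ge> 3"

text \<open>The parametrization starts and ends in a mark; hence every edge is the image of an open
  interval and none wraps around the base point.\<close>

locale based_curve = marked_curve g X for g X :: "'a::real_normed_vector set" +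
  fixes c :: "real \<Rightarrow> 'a" and p :: 'a
  assumes simple_c: "simple_path c" and c0: "c 0 = p" and c1: "c 1 = p" and image_c: "c ` {0..1} = g"
    and p_X: "p \<in> X"

context marked_curve
begin

lemma based:
  assumes "p \<in> X" obtains c where "based_curve g X c p"
proof -
  obtain c where c: "simple_path c" "pathfinish c = pathstart c" "path_image c = g" using curve by blast
  then obtain a where a: "a \<in> {0..1}" "c a = p" using assms X_sub unfolding path_image_def by blast
  let ?c = "shiftpath a c"
  have "simple_path ?c" using simple_path_shiftpath c a by auto
  moreover have "?c 0 = p" "?c 1 = p"
    using a pathstart_shiftpath[of a c] pathfinish_shiftpath[of a c] c unfolding pathstart_def pathfinish_def by auto
  moreover have "?c ` {0..1} = g"
    using path_image_shiftpath[OF a(1) c(2)] c(3) unfolding path_image_def by simp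
  ultimately have "based_curve g X ?c p" by unfold_locales (use assms in auto)
  then show thesis using that by blast
qed

lemma X_nonempty: "X \<noteq> {}" using card_X by auto

end

context based_curve
begin

lemma c_inj: "\<lbrakk>t \<in> {0<..<1}; s \<in> {0..1}; c s = c t\<rbrakk> \<Longrightarrow> s = t"
  using simple_c unfolding simple_path_def loop_free_def by force

lemma cont_c: "continuous_on {0..1} c"
  using simple_c unfolding simple_path_def path_def by blast

lemma c_eq_p: "t \<in> {0..1} \<Longrightarrow> c t = p \<longleftrightarrow> t = 0 \<or> t = 1"
  using c_inj[of t 0] c0 c1 by fastforce

lemma connected_image: "I \<subseteq> {0..1} \<Longrightarrow> connected I \<Longrightarrow> connected (c ` I)"
  by (metis cont_c connected_continuous_image continuous_on_subset)

lemma closed_image: "I \<subseteq> {0..1} \<Longrightarrow> closed I \<Longrightarrow> closed (c ` I)"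
  by (metis cont_c compact_continuous_image continuous_on_subset compact_Icc compact_Int_closed compact_imp_closed inf.absorb2)

definition gap :: "real \<Rightarrow> real \<Rightarrow> bool" where
  "gap a b \<longleftrightarrow> 0 \<le> a \<and> a < b \<and> b \<le> 1 \<and> c a \<in> X \<and> c b \<in> X \<and> (\<forall>t. a < t \<and> t < b \<longrightarrow> c t \<notin> X)"

lemma inner_mark:
  obtains t where "0 < t" "t < 1" "c t \<in> X" "c t \<noteq> p"
proof -
  have "\<not> X \<subseteq> {p}" using card_X card_mono[of "{p}" X] by auto
  then obtain q where q: "q \<in> X" "q \<noteq> p" by blast
  then obtain t where t: "t \<in> {0..1}" "c t = q" using X_sub image_c by blast
  then have "t \<noteq> 0" "t \<noteq> 1" using q c0 c1 by auto
  then show thesis using that[of t] t q by auto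
qed

lemma gap_proper: assumes "gap a b" shows "c a \<noteq> c b" "0 < a \<or> b < 1"
proof -
  obtain t where t: "0 < t" "t < 1" "c t \<in> X" using inner_mark by blast
  show *: "0 < a \<or> b < 1"
  proof (rule ccontr)
    assume "\<not> ?thesis"
    then have "a = 0" "b = 1" using assms unfolding gap_def by auto
    then show False using t assms unfolding gap_def by auto
  qed
  show "c a \<noteq> c b"
  proof
    assume eq: "c a = c b"
    have "a \<in> {0<..<1} \<or> b \<in> {0<..<1}" using * assms unfolding gap_def by auto
    then show False using c_inj[of a b] c_inj[of b a] eq assms unfolding gap_def by auto
  qed
qed

lemma gap_compl:
  assumes "gap a b" shows "g - c ` {a<..<b} = c ` {0..a} \<union> c ` {b..1}"
proof -
  have ab: "0 \<le> a" "a < b" "b \<le> 1" using assms unfolding gap_def by auto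
  have split: "{0..1} = {0..a} \<union> {b..1} \<union> {a<..<b}" using ab by auto
  have "c t \<notin> c ` {a<..<b}" if "t \<in> {0..a} \<union> {b..1}" for t
  proof
    assume "c t \<in> c ` {a<..<b}"
    then obtain s where "s \<in> {a<..<b}" "c t = c s" by auto
    then have "t = s" using c_inj[of s t] that ab by auto
    then show False using that \<open>s \<in> {a<..<b}\<close> by auto
  qed
  then have "(c ` {0..a} \<union> c ` {b..1}) \<inter> c ` {a<..<b} = {}" unfolding image_Un[symmetric] by blast
  moreover have "g = c ` {0..a} \<union> c ` {b..1} \<union> c ` {a<..<b}"
    unfolding image_c[symmetric] split image_Un ..
  ultimately show ?thesis by blast
qed

lemma gap_image_Int: assumes "gap a b" shows "c ` {a..b} \<inter> X = {c a, c b}" "c ` {a<..<b} = c ` {a..b} - X"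
    "c ` {a<..<b} = (g - X) - (c ` {0..a} \<union> c ` {b..1})"
proof -
  have ab: "0 \<le> a" "a < b" "b \<le> 1" "c a \<in> X" "c b \<in> X" and no: "\<And>t. a < t \<Longrightarrow> t < b \<Longrightarrow> c t \<notin> X"
    using assms unfolding gap_def by auto
  have split: "{a..b} = insert a (insert b {a<..<b})" using ab by auto
  show "c ` {a..b} \<inter> X = {c a, c b}" "c ` {a<..<b} = c ` {a..b} - X" unfolding split using ab no by auto
  have "c ` {a<..<b} \<subseteq> g" using image_c ab by auto
  then show "c ` {a<..<b} = (g - X) - (c ` {0..a} \<union> c ` {b..1})" 
    using gap_compl[OF assms] no by auto
qed

lemma gap_edge: assumes "gap a b" shows "c ` {a<..<b} \<in> edges g X"
proof -
  let ?e = "c ` {a<..<b}"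
  have ab: "0 \<le> a" "a < b" "b \<le> 1" using assms unfolding gap_def by auto
  have "?e \<noteq> {}" using ab by auto
  moreover have sub: "?e \<subseteq> g - X" using gap_image_Int(3)[OF assms] by auto
  moreover have con: "connected ?e" by (rule connected_image) (use ab in auto)
  moreover have "D = ?e" if D: "?e \<subseteq> D" "D \<subseteq> g - X" "connected D" for D
  proof (rule ccontr)
    assume "D \<noteq> ?e"
    \<comment> \<open>A larger connected set would be split by two closed pieces of the curve that
      meet in marks only.\<close>
    let ?A = "c ` {a..b}" and ?B = "c ` {0..a} \<union> c ` {b..1}"
    have cl: "closed ?A" "closed ?B" using ab by (auto intro!: closed_image)
    have "D \<subseteq> ?A \<union> ?B" using D gap_image_Int[OF assms] by auto
    moreover have "?A \<inter> ?B \<inter> D = {}" using D gap_image_Int[OF assms] by blast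
    moreover have "?A \<inter> D \<noteq> {}" using \<open>?e \<noteq> {}\<close> D gap_image_Int(2)[OF assms] by blast
    moreover have "?B \<inter> D \<noteq> {}"
    proof -
      obtain x where x: "x \<in> D" "x \<notin> ?e" using \<open>D \<noteq> ?e\<close> D(1) by auto
      then have "x \<in> ?B" using D(2) unfolding gap_image_Int(3)[OF assms] by blast
      then show ?thesis using x by blast
    qed
    ultimately show False using connected_closedD[OF D(3) _ _ cl] by simp
  qed
  ultimately show ?thesis unfolding edges_def in_components_maximal by blast
qed

lemma closure_gap: assumes "gap a b" shows "closure (c ` {a<..<b}) = c ` {a..b}"
proof
  have ab: "0 \<le> a" "a < b" "b \<le> 1" using assms unfolding gap_def by auto
  show "closure (c ` {a<..<b}) \<subseteq> c ` {a..b}"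
    by (rule closure_minimal) (use ab in \<open>auto intro!: closed_image\<close>)
  have "c ` closure {a<..<b} \<subseteq> closure (c ` {a<..<b})"
    by (rule image_closure_subset) (use ab closure_subset[of "c ` {a<..<b}"] in \<open>auto intro: continuous_on_subset[OF cont_c]\<close>)
  then show "c ` {a..b} \<subseteq> closure (c ` {a<..<b})" using ab by simp
qed

definition params :: "real set" where "params = {t \<in> {0..1}. c t \<in> X}"

lemma finite_params: "finite params"
proof -
  have "inj_on c (params - {0, 1})"
    unfolding params_def by (rule inj_onI) (use c_inj in auto)
  moreover have "finite (c ` (params - {0, 1}))"
    by (rule finite_subset[OF _ finite_X]) (auto simp: params_def)
  ultimately have "finite (params - {0, 1})" using finite_imageD by blast
  then show ?thesis by simp
qed

lemma gap_around:
  assumes "t \<in> {0..1}" "c t \<notin> X" obtains a b where "gap a b" "a < t" "t < b"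
proof -
  have "t \<noteq> 0" "t \<noteq> 1" using assms c0 c1 p_X by auto
  then have t: "0 < t" "t < 1" using assms by auto
  let ?L = "{s \<in> params. s < t}" and ?R = "{s \<in> params. t < s}"
  have fin: "finite ?L" "finite ?R" using finite_params by auto
  have ne: "?L \<noteq> {}" "?R \<noteq> {}" using t c0 c1 p_X unfolding params_def by force+
  have a: "Max ?L \<in> ?L" and b: "Min ?R \<in> ?R" using Max_in Min_in fin ne by blast+
  have "gap (Max ?L) (Min ?R)"
    unfolding gap_def
  proof (intro conjI allI impI)
    show "0 \<le> Max ?L" "c (Max ?L) \<in> X" "Min ?R \<le> 1" "c (Min ?R) \<in> X" "Max ?L < Min ?R"
      using a b unfolding params_def by auto
    fix s assume s: "Max ?L < s \<and> s < Min ?R"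
    show "c s \<notin> X"
    proof
      assume "c s \<in> X"
      then have "s \<in> params" using s a b unfolding params_def by auto
      moreover have "s \<noteq> t" using \<open>c s \<in> X\<close> assms by auto
      ultimately have "s \<in> ?L \<or> s \<in> ?R" by auto
      then show False using Max_ge[OF fin(1), of s] Min_le[OF fin(2), of s] s by auto
    qed
  qed
  then show thesis using that a b by auto
qed

lemma edges_gap: assumes "e \<in> edges g X" obtains a b where "gap a b" "e = c ` {a<..<b}"
proof -
  have e: "e \<noteq> {}" "e \<subseteq> g - X" 
    using assms in_components_nonempty in_components_subset unfolding edges_def by blast+
  then obtain x where x: "x \<in> e" by auto
  then have "x \<in> g" "x \<notin> X" using e by auto
  then obtain t where t: "t \<in> {0..1}" "c t = x" using image_c by auto
  then obtain a b where ab: "gap a b" "a < t" "t < b" using gap_around[of t] \<open>x \<notin> X\<close> by auto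
  have "x \<in> c ` {a<..<b}" using ab t by auto
  then have "e = c ` {a<..<b}" 
    using components_eq[of e "g - X" "c ` {a<..<b}"] assms gap_edge[OF ab(1)] x unfolding edges_def by blast
  then show thesis using that ab by blast
qed

lemma gap_unique_left: "gap 0 b \<Longrightarrow> gap 0 b' \<Longrightarrow> b = b'"
  unfolding gap_def by (metis linorder_neqE_linordered_idom)

lemma gap_unique_right: "gap a 1 \<Longrightarrow> gap a' 1 \<Longrightarrow> a = a'"
  unfolding gap_def by (metis linorder_neqE_linordered_idom)

text \<open>The first and the last parameter of a mark strictly between 0 and 1; they differ because
  there are at least two marks besides \<open>p\<close>.\<close>

lemma outer_gaps:
  obtains s u where "gap 0 s" "gap u 1" "s < u"
    "\<And>t. 0 < t \<Longrightarrow> t < 1 \<Longrightarrow> c t \<in> X \<Longrightarrow> s \<le> t \<and> t \<le> u"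
proof -
  let ?K = "params - {0, 1}"
  have fin: "finite ?K" using finite_params by auto
  obtain t where "0 < t" "t < 1" "c t \<in> X" using inner_mark by blast
  then have "t \<in> ?K" unfolding params_def by auto
  then have ne: "?K \<noteq> {}" by blast
  let ?s = "Min ?K" and ?u = "Max ?K"
  have s: "?s \<in> ?K" and u: "?u \<in> ?K" by (rule Min_in[OF fin ne], rule Max_in[OF fin ne])
  then have s': "0 < ?s" "?s < 1" "c ?s \<in> X" and u': "0 < ?u" "?u < 1" "c ?u \<in> X"
    unfolding params_def by auto
  have btw: "?s \<le> t \<and> t \<le> ?u" if "0 < t" "t < 1" "c t \<in> X" for t
  proof -
    have "t \<in> ?K" using that unfolding params_def by auto
    then show ?thesis using Min_le[OF fin] Max_ge[OF fin] by simp
  qed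
  have "c t \<notin> X" if "0 < t" "t < ?s" for t
    using btw[of t] that s'(2) by linarith
  then have "gap 0 ?s" unfolding gap_def using s' c0 p_X by simp
  moreover have "c t \<notin> X" if "?u < t" "t < 1" for t
    using btw[of t] that u'(1) by linarith
  then have "gap ?u 1" unfolding gap_def using u' c1 p_X by simp
  moreover have "?s < ?u"
  proof (rule ccontr)
    assume "\<not> ?s < ?u"
    then have *: "t = ?s" if "0 < t" "t < 1" "c t \<in> X" for t using btw[OF that] by auto
    have "X \<subseteq> {p, c ?s}"
    proof
      fix x assume x: "x \<in> X"
      then obtain t where t: "t \<in> {0..1}" "c t = x" using X_sub image_c by blast
      show "x \<in> {p, c ?s}" using *[of t] t x c0 c1 by (cases "t = 0 \<or> t = 1") auto
    qed
    then have "card X \<le> card {p, c ?s}" by (rule card_mono[rotated]) auto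
    then show False using card_X by (simp add: card_insert_if split: if_splits)
  qed
  ultimately show thesis using that btw by blast
qed

end

context marked_curve
begin

text \<open>Without the edge the curve falls into two closed pieces that meet in the base point, so
  it stays connected. Janiszewski's theorem will use this with \<open>g - e\<close> as the
  intersection.\<close>

lemma edge_props:
  assumes "e \<in> edges g X"
  obtains x y \<gamma> where "x \<noteq> y" "x \<in> X" "y \<in> X" "closure e = e \<union> {x, y}" "closure e \<inter> X = {x, y}"
    "arc \<gamma>" "path_image \<gamma> = closure e" "pathstart \<gamma> = x" "pathfinish \<gamma> = y"
    "connected (g - e)" "closed (g - e)"
proof -
  obtain p where p: "p \<in> X" using X_nonempty by auto
  obtain c where "based_curve g X c p" using based[OF p] .
  then interpret based_curve g X c p .
  obtain a b where ab: "gap a b" "e = c ` {a<..<b}" using edges_gap[OF assms] .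
  have i: "0 \<le> a" "a < b" "b \<le> 1" "c a \<in> X" "c b \<in> X" using ab(1) unfolding gap_def by auto
  have cl: "closure e = c ` {a..b}" using closure_gap[OF ab(1)] ab(2) by simp
  have split: "{a..b} = {a<..<b} \<union> {a, b}" using i by auto
  have "closure e = c ` {a<..<b} \<union> c ` {a, b}" unfolding cl split image_Un ..
  then have "closure e = e \<union> {c a, c b}" using ab(2) by simp
  moreover have "arc (subpath a b c)"
    using arc_simple_path_subpath[OF simple_c] i gap_proper(1)[OF ab(1)] by auto
  moreover have "path_image (subpath a b c) = closure e" using cl i by (simp add: path_image_subpath)
  moreover have comp: "g - e = c ` {0..a} \<union> c ` {b..1}" using gap_compl[OF ab(1)] ab(2) by simp
  moreover have "connected (c ` {0..a} \<union> c ` {b..1})"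
  proof (rule connected_Un)
    show "connected (c ` {0..a})" "connected (c ` {b..1})" using i by (auto intro!: connected_image)
    have "p \<in> c ` {0..a}" by (rule image_eqI[of _ _ 0]) (use c0 i in auto)
    moreover have "p \<in> c ` {b..1}" by (rule image_eqI[of _ _ 1]) (use c1 i in auto)
    ultimately show "c ` {0..a} \<inter> c ` {b..1} \<noteq> {}" by blast
  qed
  moreover have "closed (c ` {0..a} \<union> c ` {b..1})" using i by (auto intro!: closed_image)
  moreover have "closure e \<inter> X = {c a, c b}" using gap_image_Int(1)[OF ab(1)] cl by simp
  ultimately show thesis
    using that[of "c a" "c b" "subpath a b c"] gap_proper(1)[OF ab(1)] i by simp
qed

text \<open>With the parametrization based at \<open>p\<close>, its edges are the first and the last
  gap, and without them and \<open>p\<close> the image of a closed interval is left. The last clause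
  cuts \<open>g\<close> at \<open>p\<close> and another mark; it is quantified over
  \<open>p'\<close> so that the two arcs continue the same \<open>e1\<close> and
  \<open>e2\<close>.\<close>

lemma vertex_props:
  assumes p: "p \<in> X"
  obtains e1 e2 q1 q2 where "e1 \<in> edges g X" "e2 \<in> edges g X" "e1 \<noteq> e2" 
    "closure e1 \<inter> X = {p, q1}" "closure e2 \<inter> X = {p, q2}" "q1 \<noteq> q2" "q1 \<noteq> p" "q2 \<noteq> p"
    "\<And>e. e \<in> edges g X \<Longrightarrow> p \<in> closure e \<Longrightarrow> e = e1 \<or> e = e2"
    "connected (g - ({p} \<union> e1 \<union> e2))" "closed (g - ({p} \<union> e1 \<union> e2))"
    "\<And>p'. p' \<in> X \<Longrightarrow> p' \<noteq> p \<Longrightarrow> \<exists>c1 c2. connected c1 \<and> connected c2 \<and> e1 \<subseteq> c1 \<and> e2 \<subseteq> c2 \<and> c1 \<union> c2 = g - {p, p'}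
      \<and> closure c1 = c1 \<union> {p, p'} \<and> closure c2 = c2 \<union> {p, p'}"
proof -
  obtain c where "based_curve g X c p" using based[OF p] .
  then interpret based_curve g X c p .
  obtain s u where su: "gap 0 s" "gap u 1" "s < u"
    and btw: "\<And>t. 0 < t \<Longrightarrow> t < 1 \<Longrightarrow> c t \<in> X \<Longrightarrow> s \<le> t \<and> t \<le> u"
    by (rule outer_gaps) blast
  have i: "0 < s" "u < 1" "c s \<in> X" "c u \<in> X" using su unfolding gap_def by auto
  let ?e1 = "c ` {0<..<s}" and ?e2 = "c ` {u<..<1}"
  have ends: "closure ?e1 \<inter> X = {p, c s}" "closure ?e2 \<inter> X = {p, c u}"
    using closure_gap[OF su(1)] closure_gap[OF su(2)] gap_image_Int(1)[OF su(1)] gap_image_Int(1)[OF su(2)] c0 c1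
    by auto
  have neq: "c s \<noteq> c u" "c s \<noteq> p" "c u \<noteq> p"
    using c_inj[of s u] c_eq_p[of s] c_eq_p[of u] i su by auto
  then have e12: "?e1 \<noteq> ?e2" using ends by (metis doubleton_eq_iff)
  have only: "e = ?e1 \<or> e = ?e2" if e: "e \<in> edges g X" "p \<in> closure e" for e
  proof -
    obtain a b where ab: "gap a b" "e = c ` {a<..<b}" using edges_gap[OF e(1)] .
    have "p \<in> c ` {a..b}" using e(2) closure_gap[OF ab(1)] ab(2) by simp
    then obtain t where "t \<in> {a..b}" "c t = p" by auto
    then have "a = 0 \<or> b = 1" using c_eq_p[of t] ab(1) unfolding gap_def by auto
    then show ?thesis using gap_unique_left[OF su(1), of b] gap_unique_right[OF su(2), of a] ab by auto
  qed
  have rest: "g - ({p} \<union> ?e1 \<union> ?e2) = c ` {s..u}"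
  proof -
    have "g - ?e1 - ?e2 = (c ` {0..0} \<union> c ` {s..1}) \<inter> (c ` {0..u} \<union> c ` {1..1})"
      using gap_compl[OF su(1)] gap_compl[OF su(2)] by auto
    moreover have "(c ` {0..0} \<union> c ` {s..1}) \<inter> (c ` {0..u} \<union> c ` {1..1}) - {p} = c ` {s..u}"
    proof (intro equalityI subsetI)
      fix x assume x: "x \<in> (c ` {0..0} \<union> c ` {s..1}) \<inter> (c ` {0..u} \<union> c ` {1..1}) - {p}"
      then have "x \<in> c ` {s..1}" "x \<in> c ` {0..u}" "x \<noteq> p" using c0 c1 by auto
      then obtain t t' where t: "t \<in> {s..1}" "x = c t" "t' \<in> {0..u}" "x = c t'" by auto
      then have "t \<noteq> 1" "t' \<noteq> 0" using \<open>x \<noteq> p\<close> c0 c1 by auto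
      then have "t = t'" using c_inj[of t' t] t i by auto
      then show "x \<in> c ` {s..u}" using t by auto
    next
      fix x assume "x \<in> c ` {s..u}"
      then obtain t where t: "t \<in> {s..u}" "x = c t" by auto
      then have "x \<noteq> p" using c_eq_p[of t] i by auto
      then show "x \<in> (c ` {0..0} \<union> c ` {s..1}) \<inter> (c ` {0..u} \<union> c ` {1..1}) - {p}" using t i by auto
    qed
    moreover have "g - ({p} \<union> ?e1 \<union> ?e2) = g - ?e1 - ?e2 - {p}" by blast
    ultimately show ?thesis by simp
  qed
  have arcs: "\<exists>c1 c2. connected c1 \<and> connected c2 \<and> ?e1 \<subseteq> c1 \<and> ?e2 \<subseteq> c2 \<and> c1 \<union> c2 = g - {p, p'}
      \<and> closure c1 = c1 \<union> {p, p'} \<and> closure c2 = c2 \<union> {p, p'}"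
    if p': "p' \<in> X" "p' \<noteq> p" for p'
  proof -
    obtain t where t: "t \<in> {0..1}" "c t = p'" using p'(1) X_sub image_c by blast
    have "t \<noteq> 0" "t \<noteq> 1" using t p' c0 c1 by auto
    then have t01: "0 < t" "t < 1" using t by auto
    then have stu: "s \<le> t" "t \<le> u" using btw[of t] t p' by auto
    have cl: "closure (c ` {a<..<b}) = c ` {a..b}" if "0 \<le> a" "a < b" "b \<le> 1" for a b
    proof
      show "closure (c ` {a<..<b}) \<subseteq> c ` {a..b}"
        by (rule closure_minimal) (use that in \<open>auto intro!: closed_image\<close>)
      have "c ` closure {a<..<b} \<subseteq> closure (c ` {a<..<b})"
        by (rule image_closure_subset)
          (use that closure_subset[of "c ` {a<..<b}"] in \<open>auto intro: continuous_on_subset[OF cont_c]\<close>)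
      then show "c ` {a..b} \<subseteq> closure (c ` {a<..<b})" using that by simp
    qed
    have sp: "{0..t} = {0<..<t} \<union> {0, t}" "{t..1} = {t<..<1} \<union> {1, t}" using t01 by auto
    have "closure (c ` {0<..<t}) = c ` {0<..<t} \<union> {p, p'}" "closure (c ` {t<..<1}) = c ` {t<..<1} \<union> {p, p'}"
      using cl[of 0 t] cl[of t 1] t01 t c0 c1 unfolding sp by (simp_all add: image_Un)
    moreover have "connected (c ` {0<..<t})" "connected (c ` {t<..<1})"
      using t01 by (auto intro!: connected_image)
    moreover have "?e1 \<subseteq> c ` {0<..<t}" "?e2 \<subseteq> c ` {t<..<1}" using stu by auto
    moreover have "c ` {0<..<t} \<union> c ` {t<..<1} = g - {p, p'}"
    proof (intro equalityI subsetI)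
      fix x assume "x \<in> c ` {0<..<t} \<union> c ` {t<..<1}"
      then obtain r where "r \<in> {0<..<t} \<union> {t<..<1}" "x = c r" by blast
      then have r: "0 < r" "r < 1" "r \<noteq> t" "x = c r" using t01 by auto
      then have "x \<noteq> p" "x \<noteq> p'" using c_eq_p[of r] c_inj[of t r] t01 t by auto
      then show "x \<in> g - {p, p'}" using r image_c by auto
    next
      fix x assume x: "x \<in> g - {p, p'}"
      then obtain r where r: "r \<in> {0..1}" "x = c r" using image_c by auto
      then have "r \<noteq> 0" "r \<noteq> 1" "r \<noteq> t" using x t c0 c1 by auto
      then have "r \<in> {0<..<t} \<or> r \<in> {t<..<1}" using r by auto
      then show "x \<in> c ` {0<..<t} \<union> c ` {t<..<1}" using r by auto
    qed
    ultimately show ?thesis by blast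
  qed
  have "connected (c ` {s..u})" "closed (c ` {s..u})"
    using i su by (auto intro!: connected_image closed_image)
  then show thesis
    using that[OF gap_edge[OF su(1)] gap_edge[OF su(2)] e12 ends neq only _ _ arcs] rest by simp
qed

lemma edge_cover: "g = X \<union> \<Union>(edges g X)"
  using X_sub Union_components[of "g - X"] unfolding edges_def by auto

lemma edges_disjoint: "e \<in> edges g X \<Longrightarrow> e' \<in> edges g X \<Longrightarrow> e \<inter> e' \<noteq> {} \<Longrightarrow> e = e'"
  unfolding edges_def by (metis components_eq)

lemma edge_sub: "e \<in> edges g X \<Longrightarrow> e \<subseteq> g - X" "e \<in> edges g X \<Longrightarrow> e \<noteq> {}" "e \<in> edges g X \<Longrightarrow> connected e"
  unfolding edges_def by (auto simp: in_components_subset in_components_nonempty in_components_connected dest: in_components_subset)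

lemma card_edges_at: assumes "p \<in> X" shows "card {e \<in> edges g X. p \<in> closure e} = 2"
proof -
  obtain e1 e2 q1 q2 where e: "e1 \<in> edges g X" "e2 \<in> edges g X" "e1 \<noteq> e2" 
    "closure e1 \<inter> X = {p, q1}" "closure e2 \<inter> X = {p, q2}"
    "\<And>e. e \<in> edges g X \<Longrightarrow> p \<in> closure e \<Longrightarrow> e = e1 \<or> e = e2"
    by (rule vertex_props[OF assms]) blast
  then have "{e \<in> edges g X. p \<in> closure e} = {e1, e2}" by blast
  then show ?thesis using e(3) by simp
qed

lemma finite_edges: "finite (edges g X)"
proof -
  have "edges g X \<subseteq> (\<Union>p\<in>X. {e \<in> edges g X. p \<in> closure e})"
  proof
    fix e assume e: "e \<in> edges g X"
    obtain x where "x \<in> X" "x \<in> closure e" by (rule edge_props[OF e]) blast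
    then show "e \<in> (\<Union>p\<in>X. {e \<in> edges g X. p \<in> closure e})" using e by auto
  qed
  moreover have "finite (\<Union>p\<in>X. {e \<in> edges g X. p \<in> closure e})"
    using finite_X card_edges_at by (metis (no_types, lifting) card.infinite finite_UN_I zero_neq_numeral)
  ultimately show ?thesis by (rule finite_subset)
qed

text \<open>Double counting of incidences: two edges at each mark, two marks on each edge.\<close>

lemma card_edges: "card (edges g X) = card X"
proof -
  have "2 * card X = (\<Sum>p\<in>X. card {e \<in> edges g X. p \<in> closure e})" using card_edges_at by simp
  also have "\<dots> = (\<Sum>e\<in>edges g X. card {p \<in> X. p \<in> closure e})"
    by (rule sum_multicount_gen) (auto simp: finite_X finite_edges)
  also have "\<dots> = (\<Sum>e\<in>edges g X. 2)"
  proof (rule sum.cong[OF refl])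
    fix e assume e: "e \<in> edges g X"
    obtain x y where xy: "x \<noteq> y" "closure e \<inter> X = {x, y}" by (rule edge_props[OF e]) blast
    then have "{p \<in> X. p \<in> closure e} = {x, y}" by blast
    then show "card {p \<in> X. p \<in> closure e} = 2" using xy by simp
  qed
  finally show ?thesis by simp
qed

text \<open>The closures of the edges that touch \<open>S\<close> and of those that do not form two
  disjoint closed sets covering \<open>g\<close>; by connectedness the second is empty.\<close>

lemma closed_under_ends:
  assumes S: "S \<subseteq> X" "S \<noteq> {}" and cl: "\<And>e. e \<in> edges g X \<Longrightarrow> closure e \<inter> S \<noteq> {} \<Longrightarrow> closure e \<inter> X \<subseteq> S"
  shows "S = X"
proof -
  let ?E1 = "{e \<in> edges g X. closure e \<inter> S \<noteq> {}}" and ?E2 = "{e \<in> edges g X. closure e \<inter> S = {}}"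
  let ?W1 = "\<Union>(closure ` ?E1)" and ?W2 = "\<Union>(closure ` ?E2)"
  have cls: "closed ?W1" "closed ?W2" using finite_edges by auto
  have X12: "x \<in> ?W1 \<or> x \<in> ?W2" if x: "x \<in> X" for x
  proof -
    obtain e where "e \<in> edges g X" "x \<in> closure e" by (rule vertex_props[OF x]) blast
    then show ?thesis by blast
  qed
  have W12: "g \<subseteq> ?W1 \<union> ?W2"
  proof
    fix x assume "x \<in> g"
    then consider "x \<in> X" | e where "e \<in> edges g X" "x \<in> e" using edge_cover by blast
    then show "x \<in> ?W1 \<union> ?W2"
    proof cases
      case 1 then show ?thesis using X12 by simp
    next
      case 2
      then have "x \<in> closure e" using closure_subset by blast
      then show ?thesis using 2 by blast
    qed
  qed
  have dis: "?W1 \<inter> ?W2 \<inter> g = {}"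
  proof (rule ccontr)
    assume "?W1 \<inter> ?W2 \<inter> g \<noteq> {}"
    then obtain x e1 e2 where x: "x \<in> closure e1" "x \<in> closure e2" "e1 \<in> ?E1" "e2 \<in> ?E2" by auto
    have "e \<union> (closure e \<inter> X) = closure e" if e: "e \<in> edges g X" for e
    proof -
      obtain a b where "closure e = e \<union> {a, b}" "closure e \<inter> X = {a, b}" by (rule edge_props[OF e]) blast
      then show ?thesis by simp
    qed
    then have x1: "x \<in> e1 \<or> x \<in> X" "x \<in> e2 \<or> x \<in> X" using x by blast+
    show False
    proof (cases "x \<in> X")
      case True then show ?thesis using cl[of e1] x by blast
    next
      case False then have "e1 = e2" using x1 x edges_disjoint by blast
      then show ?thesis using x by blast
    qed
  qed
  have ne: "?W1 \<inter> g \<noteq> {}"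
  proof -
    obtain x where "x \<in> S" using S by auto
    then have "x \<in> X" "x \<in> g" using S X_sub by auto
    obtain e where "e \<in> edges g X" "x \<in> closure e" by (rule vertex_props[OF \<open>x \<in> X\<close>]) blast
    then show ?thesis using \<open>x \<in> S\<close> \<open>x \<in> g\<close> by blast
  qed
  have con: "connected g" using curve connected_simple_path_image by blast
  have "?W2 \<inter> g = {}" using connected_closedD[OF con dis W12 cls] ne by blast
  then have W2: "x \<notin> ?W2" if "x \<in> X" for x using that X_sub by blast
  have "X \<subseteq> S"
  proof
    fix x assume x: "x \<in> X"
    then have "x \<in> ?W1" using X12 W2 by blast
    then obtain e where "e \<in> edges g X" "closure e \<inter> S \<noteq> {}" "x \<in> closure e" by blast
    then show "x \<in> S" using cl[of e] x by blast
  qed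
  then show ?thesis using S by auto
qed

end

section \<open>Cells and their corners\<close>

locale arrangement =
  fixes A :: "(real^3) set set"
  assumes arr: "pc_arrangement A" and simple: "simple_arrangement A"
    and three: "g \<in> A \<Longrightarrow> card {d \<in> A. d \<noteq> g \<and> g \<inter> d \<noteq> {}} \<ge> 3"
begin

abbreviation X :: "(real^3) set" where "X \<equiv> crossings A"

abbreviation E :: "(real^3) set \<Rightarrow> (real^3) set set" where "E g \<equiv> edges g (g \<inter> X)"

lemma finite_A: "finite A" using arr unfolding pc_arrangement_def by auto

lemma pc: "g \<in> A \<Longrightarrow> pseudocircle g" using arr unfolding pc_arrangement_def by auto

lemma sub_S2: "g \<in> A \<Longrightarrow> g \<subseteq> S2" using pc unfolding pseudocircle_def by auto

lemma closed_curve: "g \<in> A \<Longrightarrow> closed g" using pc compact_pseudocircle compact_imp_closed by blast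

lemma closed_Union_curves: "F \<subseteq> A \<Longrightarrow> closed (\<Union>F)"
  using closed_curve finite_A by (meson closed_Union finite_subset subsetD)

lemma card_Int: "\<lbrakk>g \<in> A; d \<in> A; g \<noteq> d; g \<inter> d \<noteq> {}\<rbrakk> \<Longrightarrow> card (g \<inter> d) = 2"
  using arr unfolding pc_arrangement_def by blast

lemma in_XI: "\<lbrakk>g \<in> A; d \<in> A; g \<noteq> d; p \<in> g; p \<in> d\<rbrakk> \<Longrightarrow> p \<in> X"
  unfolding crossings_def by blast

lemma in_XD: assumes "p \<in> X" obtains g d where "g \<in> A" "d \<in> A" "g \<noteq> d" "p \<in> g" "p \<in> d"
  using assms unfolding crossings_def by blast

lemma only_two: "\<lbrakk>g \<in> A; d \<in> A; g \<noteq> d; p \<in> g; p \<in> d; h \<in> A; p \<in> h\<rbrakk> \<Longrightarrow> h = g \<or> h = d"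
  using simple unfolding simple_arrangement_def by blast

lemma Int_curve: "g \<in> A \<Longrightarrow> d \<in> A \<Longrightarrow> finite (g \<inter> d) \<or> g = d"
  using card_Int by (metis card.infinite finite.emptyI zero_neq_numeral)

lemma finite_X: "finite X"
proof -
  have "X \<subseteq> (\<Union>g\<in>A. \<Union>d\<in>A - {g}. g \<inter> d)" unfolding crossings_def by blast
  moreover have "finite (\<Union>g\<in>A. \<Union>d\<in>A - {g}. g \<inter> d)" using finite_A Int_curve by blast
  ultimately show ?thesis by (rule finite_subset)
qed

text \<open>At least three other curves meet \<open>g\<close>, each in two points, and by simplicity
  these pairs are disjoint.\<close>

lemma card_on_curve: assumes g: "g \<in> A" shows "card (g \<inter> X) \<ge> 6"
proof -
  let ?N = "{d \<in> A. d \<noteq> g \<and> g \<inter> d \<noteq> {}}"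
  have fin: "finite ?N" using finite_A by auto
  have eq: "g \<inter> X = (\<Union>d\<in>?N. g \<inter> d)"
  proof
    show "g \<inter> X \<subseteq> (\<Union>d\<in>?N. g \<inter> d)"
    proof
      fix p assume p: "p \<in> g \<inter> X"
      then obtain h k where h: "h \<in> A" "k \<in> A" "h \<noteq> k" "p \<in> h" "p \<in> k" using in_XD by blast
      then show "p \<in> (\<Union>d\<in>?N. g \<inter> d)" using p by (cases "h = g") auto
    qed
    show "(\<Union>d\<in>?N. g \<inter> d) \<subseteq> g \<inter> X" using in_XI[OF g] by blast
  qed
  have "card (\<Union>d\<in>?N. g \<inter> d) = (\<Sum>d\<in>?N. card (g \<inter> d))"
  proof (rule card_UN_disjoint[OF fin])
    show "\<forall>d\<in>?N. finite (g \<inter> d)" using Int_curve[OF g] by blast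
    show "\<forall>d\<in>?N. \<forall>d'\<in>?N. d \<noteq> d' \<longrightarrow> g \<inter> d \<inter> (g \<inter> d') = {}" using only_two g by blast
  qed
  also have "\<dots> = (\<Sum>d\<in>?N. 2)" by (rule sum.cong[OF refl]) (use card_Int[OF g] in auto)
  also have "\<dots> = 2 * card ?N" by simp
  finally show ?thesis using three[OF g] eq by simp
qed

lemma marked: assumes "g \<in> A" shows "marked_curve g (g \<inter> X)"
proof
  show "\<exists>c. simple_path c \<and> pathfinish c = pathstart c \<and> path_image c = g"
    using pc[OF assms] unfolding pseudocircle_iff by blast
  show "3 \<le> card (g \<inter> X)" using card_on_curve[OF assms] by simp
qed (use finite_X in auto)

lemma edge_sub: assumes "g \<in> A" "e \<in> E g" shows "e \<subseteq> g" "e \<inter> X = {}" "e \<noteq> {}" "connected e"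
  using marked_curve.edge_sub[OF marked[OF assms(1)] assms(2)] by auto

lemma edge_disjoint: "\<lbrakk>g \<in> A; e \<in> E g; d \<in> A; d \<noteq> g\<rbrakk> \<Longrightarrow> e \<inter> d = {}"
  using edge_sub[of g e] in_XI[of g d] by blast

lemma closure_edge: assumes g: "g \<in> A" "e \<in> E g"
  obtains p q where "p \<noteq> q" "p \<in> g" "q \<in> g" "p \<in> X" "q \<in> X" "closure e = e \<union> {p, q}" "closure e \<inter> X = {p, q}"
proof -
  obtain p q where *: "p \<noteq> q" "p \<in> g \<inter> X" "q \<in> g \<inter> X" "closure e = e \<union> {p, q}"
    by (rule marked_curve.edge_props[OF marked[OF g(1)] g(2)]) blast
  then have "closure e \<inter> X = {p, q}" using edge_sub(2)[OF g] by blast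
  then show thesis using that * by blast
qed

lemma closure_edge_X: assumes g: "g \<in> A" "e \<in> E g" shows "closure e \<inter> (g \<inter> X) = closure e \<inter> X"
proof -
  obtain p q where "p \<in> g" "q \<in> g" "closure e \<inter> X = {p, q}" by (rule closure_edge[OF g]) blast
  moreover have "closure e \<inter> (g \<inter> X) = g \<inter> (closure e \<inter> X)" by blast
  ultimately show ?thesis by simp
qed

section \<open>Sides of a curve and components of complements\<close>

lemma comp_two:
  assumes "d \<in> A" "C \<in> components (S2 - d)" "D \<in> components (S2 - d)" "C \<noteq> D" "K \<in> components (S2 - d)"
  shows "K = C \<or> K = D"
proof -
  obtain U V where UV: "components (S2 - d) = {U, V}" by (rule Jordan_S2[OF pc[OF assms(1)]]) blast
  show ?thesis using assms(2-5) unfolding UV by auto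
qed

lemma comp_closure:
  assumes "d \<in> A" "C \<in> components (S2 - d)" shows "d \<subseteq> closure C"
proof -
  obtain U V where UV: "components (S2 - d) = {U, V}" "d \<subseteq> closure U" "d \<subseteq> closure V"
    by (rule Jordan_S2[OF pc[OF assms(1)]]) blast
  then show ?thesis using assms(2) unfolding UV(1) by auto
qed

lemma open_component:
  assumes "closed K" "C \<in> components (S2 - K)" obtains O' where "open O'" "C = S2 \<inter> O'"
proof -
  have "openin (top_of_set (S2 - K)) C"
    using openin_components_locally_connected[OF locally_open_subset[OF locally_connected_S2 openin_S2_Diff[OF assms(1)]] assms(2)] .
  then have "openin (top_of_set S2) C" using openin_S2_Diff[OF assms(1)] openin_trans by blast
  then show thesis using that unfolding openin_open by blast
qed

text \<open>Components of the complement of a closed set are open in the sphere, so a set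
  accumulating at a point of \<open>U\<close> enters \<open>U\<close> arbitrarily close to
  it.\<close>

lemma component_meets:
  assumes "closed K" "U \<in> components (S2 - K)" "x \<in> U" "x \<in> closure C" "C \<subseteq> S2" "open N" "x \<in> N"
  shows "C \<inter> U \<inter> N \<noteq> {}"
proof -
  obtain O' where O': "open O'" "U = S2 \<inter> O'" using open_component[OF assms(1,2)] .
  then have "open (O' \<inter> N)" "x \<in> O' \<inter> N" using assms by auto
  then have "C \<inter> (O' \<inter> N) \<noteq> {}" using assms(4) by (metis closure_iff_nhds_not_empty inf_commute order_refl)
  then show ?thesis using O' assms by blast
qed

lemma component_of:
  assumes "connected C" "C \<subseteq> S" "C \<noteq> {}" obtains K where "K \<in> components S" "C \<subseteq> K"
  using exists_component_superset[of C S] assms by blast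

lemma component_sub: "\<lbrakk>connected C; C \<subseteq> S; K \<in> components S; C \<inter> K \<noteq> {}\<rbrakk> \<Longrightarrow> C \<subseteq> K"
  by (metis components_maximal inf_commute)

lemma component_connected:
  "\<lbrakk>K \<in> components S; a \<in> K; b \<in> K\<rbrakk> \<Longrightarrow> connected_component S a b"
  by (meson connected_component_def in_components_connected in_components_subset)

lemma component_eq_set: assumes "C \<in> components S" "a \<in> C" shows "C = connected_component_set S a"
proof -
  obtain x where C: "C = connected_component_set S x" using assms(1) components_iff by metis
  then show ?thesis using connected_component_eq assms(2) by metis
qed

lemma cells_eqI:
  assumes "C \<in> cells A" "C' \<in> cells A" "a \<in> C" "b \<in> C'" "connected_component (S2 - \<Union>A) a b"
  shows "C = C'"
proof -
  have C: "C = connected_component_set (S2 - \<Union>A) a" "C' = connected_component_set (S2 - \<Union>A) b"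
    using component_eq_set assms unfolding cells_def by metis+
  have "b \<in> connected_component_set (S2 - \<Union>A) a" using assms(5) by simp
  then show ?thesis using C connected_component_eq by metis
qed

lemma cell_props: assumes "C \<in> cells A"
  shows "connected C" "C \<noteq> {}" "C \<subseteq> S2 - \<Union>A"
  using assms unfolding cells_def
  by (auto simp: in_components_connected in_components_nonempty dest: in_components_subset)

lemma cell_side: assumes "C \<in> cells A" "g \<in> A"
  obtains s where "s \<in> components (S2 - g)" "C \<subseteq> s"
  using component_of[of C "S2 - g"] cell_props[OF assms(1)] assms(2) by blast

text \<open>The side \<open>t\<close> is a neighbourhood in the sphere of each point of
  \<open>e\<close>, so \<open>C\<close> enters it; being connected and off \<open>d\<close>, the
  cell stays there.\<close>

lemma side_of_edge:
  assumes C: "C \<in> cells A" and g: "g \<in> A" "e \<in> E g" and d: "d \<in> A" "d \<noteq> g"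
    and t: "t \<in> components (S2 - d)" "e \<subseteq> t" and e: "e \<subseteq> closure C"
  shows "C \<subseteq> t"
proof -
  obtain x where "x \<in> e" using edge_sub(3)[OF g] by auto
  then have "C \<inter> t \<inter> UNIV \<noteq> {}"
    using component_meets[OF closed_curve[OF d(1)] t(1), of x C UNIV] t e cell_props[OF C] by blast
  then show ?thesis using component_sub[of C "S2 - d" t] cell_props[OF C] t d by blast
qed

text \<open>Cutting \<open>g\<close> at its two points on \<open>d\<close> leaves two connected
  arcs, each within one side of \<open>d\<close>. Since \<open>g\<close> meets two sides, the arcs
  lie on different ones, and with them the two edges at \<open>p\<close>.\<close>

lemma crossing_edges:
  assumes g: "g \<in> A" "d \<in> A" "g \<noteq> d" and p: "p \<in> g" "p \<in> d"
  obtains e1 e2 c1 c2 D1 D2 p' where "e1 \<in> E g" "e2 \<in> E g" "p \<in> closure e1" "p \<in> closure e2"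
    "\<And>e. e \<in> E g \<Longrightarrow> p \<in> closure e \<Longrightarrow> e = e1 \<or> e = e2"
    "D1 \<in> components (S2 - d)" "D2 \<in> components (S2 - d)" "D1 \<noteq> D2"
    "e1 \<subseteq> c1" "e2 \<subseteq> c2" "c1 \<subseteq> D1" "c2 \<subseteq> D2" "connected c1" "connected c2" "c1 \<union> c2 = g - d"
    "g \<inter> d = {p, p'}" "p \<noteq> p'"
    "closure c1 = c1 \<union> {p, p'}" "closure c2 = c2 \<union> {p, p'}"
    "connected (g - ({p} \<union> e1 \<union> e2))" "closed (g - ({p} \<union> e1 \<union> e2))"
proof -
  have pX: "p \<in> g \<inter> X" using in_XI g p by auto
  have "card (g \<inter> d) = 2" using card_Int g p by blast
  then obtain u v where uv: "g \<inter> d = {u, v}" "u \<noteq> v" unfolding card_2_iff by blast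
  have "p \<in> {u, v}" using p uv(1) by blast
  then obtain p' where p': "g \<inter> d = {p, p'}" "p \<noteq> p'" using uv by (cases "p = u") auto
  then have p'X: "p' \<in> g \<inter> X" using in_XI[of g d p'] g by blast
  obtain e1 e2 q1 q2 c1 c2 where e: "e1 \<in> E g" "e2 \<in> E g" 
      "closure e1 \<inter> (g \<inter> X) = {p, q1}" "closure e2 \<inter> (g \<inter> X) = {p, q2}"
      "\<And>e. e \<in> E g \<Longrightarrow> p \<in> closure e \<Longrightarrow> e = e1 \<or> e = e2"
      "connected (g - ({p} \<union> e1 \<union> e2))" "closed (g - ({p} \<union> e1 \<union> e2))"
      and c: "connected c1" "connected c2" "e1 \<subseteq> c1" "e2 \<subseteq> c2" "c1 \<union> c2 = g - {p, p'}"
      "closure c1 = c1 \<union> {p, p'}" "closure c2 = c2 \<union> {p, p'}"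
  proof (rule marked_curve.vertex_props[OF marked[OF g(1)] pX])
    fix e1 e2 q1 q2
    assume *: "e1 \<in> E g" "e2 \<in> E g" 
      "closure e1 \<inter> (g \<inter> X) = {p, q1}" "closure e2 \<inter> (g \<inter> X) = {p, q2}"
      "\<And>e. e \<in> E g \<Longrightarrow> p \<in> closure e \<Longrightarrow> e = e1 \<or> e = e2"
      "connected (g - ({p} \<union> e1 \<union> e2))" "closed (g - ({p} \<union> e1 \<union> e2))"
    assume "\<And>p'. p' \<in> g \<inter> X \<Longrightarrow> p' \<noteq> p \<Longrightarrow> \<exists>c1 c2. connected c1 \<and> connected c2 \<and> e1 \<subseteq> c1 \<and> e2 \<subseteq> c2
      \<and> c1 \<union> c2 = g - {p, p'} \<and> closure c1 = c1 \<union> {p, p'} \<and> closure c2 = c2 \<union> {p, p'}"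
    from this[OF p'X p'(2)[symmetric]] show thesis
      by (elim exE conjE) (rule that; (rule * | assumption)+)
  qed
  have cd: "c1 \<union> c2 = g - d" using c(5) p'(1) by blast
  have ne: "c1 \<noteq> {}" "c2 \<noteq> {}" using c e(1,2) edge_sub(3)[OF g(1)] by blast+
  have "c1 \<subseteq> S2 - d" "c2 \<subseteq> S2 - d" using cd sub_S2[OF g(1)] by blast+
  then obtain D1 D2 where D: "D1 \<in> components (S2 - d)" "c1 \<subseteq> D1" "D2 \<in> components (S2 - d)" "c2 \<subseteq> D2"
    using component_of[OF c(1) _ ne(1)] component_of[OF c(2) _ ne(2)] by metis
  have "crosses g d" using arr g p unfolding pc_arrangement_def by blast
  then obtain C1 C2 where C: "C1 \<in> components (S2 - d)" "C2 \<in> components (S2 - d)" "C1 \<noteq> C2"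
    "g \<inter> C1 \<noteq> {}" "g \<inter> C2 \<noteq> {}" unfolding crosses_def by blast
  have "K = D1 \<or> K = D2" if K: "K \<in> components (S2 - d)" "g \<inter> K \<noteq> {}" for K
  proof -
    obtain x where x: "x \<in> g" "x \<in> K" using K by blast
    then have "x \<notin> d" using K(1) in_components_subset by blast
    then have "x \<in> D1 \<or> x \<in> D2" using cd D x by blast
    then show ?thesis using D K(1) x by (metis IntI components_eq empty_iff)
  qed
  then have "D1 \<noteq> D2" using C by metis
  then show thesis 
    using that[OF e(1,2) _ _ e(5) D(1,3) _ c(3,4) D(2,4) c(1,2) cd p' c(6,7) e(6,7)] e(3,4) by blast
qed

text \<open>With \<open>c\<close> the arc of \<open>g\<close> on the far side of \<open>d\<close>, neither \<open>g\<close> nor \<open>d \<union> c\<close> separates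
  \<open>a\<close> from \<open>b\<close>, and they meet in the closure of \<open>c\<close>.\<close>

lemma same_sides:
  assumes g: "g \<in> A" "d \<in> A" "g \<noteq> d" and p: "p \<in> g" "p \<in> d"
    and ab: "connected_component (S2 - g) a b" "connected_component (S2 - d) a b"
  shows "connected_component (S2 - (g \<union> d)) a b"
proof -
  obtain c1 c2 D1 D2 p' where *: "D1 \<in> components (S2 - d)" "D2 \<in> components (S2 - d)" "D1 \<noteq> D2"
    "c1 \<subseteq> D1" "c2 \<subseteq> D2" "connected c1" "connected c2" "c1 \<union> c2 = g - d" "g \<inter> d = {p, p'}"
    "closure c1 = c1 \<union> {p, p'}" "closure c2 = c2 \<union> {p, p'}"
    by (rule crossing_edges[OF g p]) blast
  let ?K = "connected_component_set (S2 - d) a"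
  have "a \<in> S2 - d" using ab connected_component_in by blast
  then have K: "?K \<in> components (S2 - d)" "a \<in> ?K" "b \<in> ?K"
    using ab by (auto simp: componentsI connected_component_refl)
  obtain c where c: "connected c" "c \<subseteq> g - d" "closure c = c \<union> {p, p'}" "c \<inter> ?K = {}"
  proof (cases "?K = D1")
    case True
    then have "D2 \<inter> ?K = {}" using components_nonoverlap[OF K(1) *(2)] *(3) by (simp add: inf_commute)
    then show thesis using that[of c2] * by blast
  next
    case False
    then have "D1 \<inter> ?K = {}" using components_nonoverlap[OF K(1) *(1)] by (simp add: inf_commute)
    then show thesis using that[of c1] * by blast
  qed
  let ?T = "d \<union> closure c"
  have T: "?T = d \<union> c" using c(3) *(9) by blast
  have "connected_component (S2 - (g \<union> ?T)) a b"
  proof (rule Janiszewski_S2)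
    show "closed g" "g \<subseteq> S2" "g \<noteq> {}" using closed_curve sub_S2 g p by auto
    show "closed ?T" using closed_curve g by auto
    show "?T \<subseteq> S2" "?T \<noteq> {}" unfolding T using sub_S2[OF g(1)] sub_S2[OF g(2)] c(2) p by blast+
    have "g \<inter> ?T = closure c" unfolding T using c(2,3) *(9) by blast
    then show "connected (g \<inter> ?T)" using c(1) by (simp add: connected_imp_connected_closure)
    show "connected_component (S2 - g) a b" by fact
    have "?K \<subseteq> S2 - ?T" unfolding T using c(4) connected_component_subset[of "S2 - d" a] by blast
    then show "connected_component (S2 - ?T) a b"
      using K unfolding connected_component_def[of "S2 - ?T"] by (metis connected_connected_component)
  qed
  moreover have "g \<union> ?T = g \<union> d" unfolding T using c(2) by blast
  ultimately show ?thesis by simp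
qed

text \<open>The set \<open>?T\<close> is the union of all curves without the open edge, and
  \<open>g\<close> meets it in the connected set \<open>g - e\<close>. By Janiszewski's theorem the
  points of \<open>s\<close> in the component \<open>U\<close> around \<open>e\<close> all lie in
  one cell, and every point of \<open>e\<close> is a limit of such points.\<close>

lemma edge_cell:
  assumes g: "g \<in> A" "e \<in> E g" and s: "s \<in> components (S2 - g)"
  obtains C where "C \<in> cells A" "C \<subseteq> s" "e \<subseteq> closure C"
proof -
  let ?T = "\<Union>(A - {g}) \<union> (g - e)"
  have e: "e \<subseteq> g" "e \<noteq> {}" "connected e" using edge_sub[OF g] by auto
  obtain h: "connected (g - e)" "closed (g - e)"
    by (rule marked_curve.edge_props[OF marked[OF g(1)] g(2)]) blast
  have eT: "e \<inter> ?T = {}" using edge_disjoint[OF g] by blast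
  have gT: "g \<union> ?T = \<Union>A" "g \<inter> ?T = g - e" using g e eT by blast+
  have clT: "closed ?T" using h closed_Union_curves[of "A - {g}"] by auto
  have sS: "s \<subseteq> S2 - g" using s in_components_subset by blast
  obtain U where U: "U \<in> components (S2 - ?T)" "e \<subseteq> U"
    using component_of[OF e(3), of "S2 - ?T"] e eT sub_S2[OF g(1)] by blast
  have meet: "s \<inter> U \<inter> N \<noteq> {}" if "y \<in> e" "open N" "y \<in> N" for y N
    using component_meets[OF clT U(1), of y s N] that U e comp_closure[OF g(1) s] sS by blast
  obtain x where "x \<in> e" using e by auto
  then obtain a where a: "a \<in> s" "a \<in> U" using meet[of x UNIV] by auto
  have "a \<notin> g \<union> ?T" using a sS U(1) in_components_subset by blast
  then have "a \<in> S2 - \<Union>A" using gT a sS by auto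
  then obtain C where C: "C \<in> cells A" "a \<in> C"
    unfolding cells_def by (metis componentsI connected_component_refl mem_Collect_eq)
  have inC: "b \<in> C" if b: "b \<in> s" "b \<in> U" for b
  proof -
    have gne: "g - e \<noteq> {}" by (rule closure_edge[OF g]) (use edge_sub(2)[OF g] in blast)
    have "connected_component (S2 - (g \<union> ?T)) a b"
    proof (rule Janiszewski_S2)
      show "closed g" "g \<subseteq> S2" "g \<noteq> {}" using closed_curve sub_S2 g e by auto
      show "closed ?T" by fact
      show "?T \<subseteq> S2" using sub_S2 g(1) by blast
      show "?T \<noteq> {}" using gne by blast
      show "connected (g \<inter> ?T)" using gT h by simp
      show "connected_component (S2 - g) a b" using component_connected[OF s] a b by blast
      show "connected_component (S2 - ?T) a b" using component_connected[OF U(1)] a b by blast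
    qed
    then have "connected_component (S2 - \<Union>A) a b" using gT by simp
    moreover have "C = connected_component_set (S2 - \<Union>A) a"
      using component_eq_set C unfolding cells_def by metis
    ultimately show ?thesis by simp
  qed
  have "e \<subseteq> closure C"
  proof
    fix y assume y: "y \<in> e"
    have "\<exists>c\<in>C. c \<in> N" if "open N" "y \<in> N" for N
      using meet[OF y that] inC by blast
    then show "y \<in> closure C" unfolding closure_iff_nhds_not_empty by blast
  qed
  moreover have "C \<subseteq> s" using component_sub[of C "S2 - g" s] cell_props[OF C(1)] s a C g by blast
  ultimately show thesis using that C by blast
qed

text \<open>Taking \<open>p\<close> and the four edges at it out of the curves leaves a closed set
  \<open>T\<close> that does not separate points close to \<open>p\<close>. Neither does
  \<open>g \<union> d\<close>, by \<open>same_sides\<close>. The two sets meet in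
  \<open>G \<union> D\<close>, which is connected because both remainders contain the second
  crossing \<open>p'\<close>.\<close>

lemma cell_unique:
  assumes g: "g \<in> A" "d \<in> A" "g \<noteq> d" and p: "p \<in> g" "p \<in> d"
    and s: "s \<in> components (S2 - g)" and t: "t \<in> components (S2 - d)"
    and C: "C \<in> cells A" "p \<in> closure C" "C \<subseteq> s" "C \<subseteq> t"
    and C': "C' \<in> cells A" "p \<in> closure C'" "C' \<subseteq> s" "C' \<subseteq> t"
  shows "C = C'"
proof -
  obtain e1 e2 p' where e: "e1 \<in> E g" "e2 \<in> E g" "g \<inter> d = {p, p'}" "p \<noteq> p'"
    "connected (g - ({p} \<union> e1 \<union> e2))" "closed (g - ({p} \<union> e1 \<union> e2))"
    by (rule crossing_edges[OF g p]) blast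
  obtain f1 f2 where f: "f1 \<in> E d" "f2 \<in> E d"
    "connected (d - ({p} \<union> f1 \<union> f2))" "closed (d - ({p} \<union> f1 \<union> f2))"
    by (rule crossing_edges[OF g(2,1) g(3)[symmetric] p(2,1)]) blast
  define G where "G = g - ({p} \<union> e1 \<union> e2)"
  define D where "D = d - ({p} \<union> f1 \<union> f2)"
  define T where "T = \<Union>(A - {g, d}) \<union> (G \<union> D)"
  have p'X: "p' \<in> X" "p' \<in> g" "p' \<in> d" using in_XI[of g d p'] g e(3) by blast+
  have p'in: "p' \<in> G" "p' \<in> D"
    unfolding G_def D_def using p'X e(4) edge_sub(2)[OF g(1) e(1)] edge_sub(2)[OF g(1) e(2)]
      edge_sub(2)[OF g(2) f(1)] edge_sub(2)[OF g(2) f(2)] by blast+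
  have conGD: "connected (G \<union> D)" by (rule connected_Un) (use e f p'in G_def D_def in auto)
  have pnot: "p \<notin> T"
    unfolding T_def G_def D_def using only_two[OF g p] by blast
  have clT: "closed T" unfolding T_def using e f G_def D_def closed_Union_curves[of "A - {g, d}"] by auto
  have TS: "T \<subseteq> S2" unfolding T_def G_def D_def using sub_S2 g by blast
  have un: "(g \<union> d) \<union> T = \<Union>A" unfolding T_def G_def D_def using g by blast
  \<comment> \<open>A further curve meets \<open>g\<close> or \<open>d\<close> only in crossings
    other than \<open>p\<close>, and these lie on no open edge.\<close>
  have int: "(g \<union> d) \<inter> T = G \<union> D"
  proof
    show "G \<union> D \<subseteq> (g \<union> d) \<inter> T" unfolding T_def G_def D_def by blast
    show "(g \<union> d) \<inter> T \<subseteq> G \<union> D"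
    proof
      fix x assume x: "x \<in> (g \<union> d) \<inter> T"
      show "x \<in> G \<union> D"
      proof (cases "x \<in> G \<union> D")
        case False
        then obtain h where h: "h \<in> A" "h \<noteq> g" "h \<noteq> d" "x \<in> h" using x unfolding T_def by blast
        then have "x \<noteq> p" using only_two[OF g p] by blast
        consider "x \<in> g" | "x \<in> d" using x by blast
        then show ?thesis
        proof cases
          case 1
          then have "x \<in> X" using in_XI[of g h x] h g by blast
          then have "x \<in> G" unfolding G_def using 1 \<open>x \<noteq> p\<close> edge_sub(2)[OF g(1) e(1)] edge_sub(2)[OF g(1) e(2)] by blast
          then show ?thesis by blast
        next
          case 2
          then have "x \<in> X" using in_XI[of d h x] h g by blast
          then have "x \<in> D" unfolding D_def using 2 \<open>x \<noteq> p\<close> edge_sub(2)[OF g(2) f(1)] edge_sub(2)[OF g(2) f(2)] by blast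
          then show ?thesis by blast
        qed
      qed auto
    qed
  qed
  have "p \<in> S2 - T" using pnot sub_S2[OF g(1)] p by blast
  then obtain U where U: "U \<in> components (S2 - T)" "p \<in> U"
    by (metis componentsI connected_component_refl mem_Collect_eq)
  obtain a where a: "a \<in> C" "a \<in> U"
    using component_meets[OF clT U C(2), of UNIV] cell_props(3)[OF C(1)] by blast
  obtain b where b: "b \<in> C'" "b \<in> U"
    using component_meets[OF clT U C'(2), of UNIV] cell_props(3)[OF C'(1)] by blast
  have "connected_component (S2 - ((g \<union> d) \<union> T)) a b"
  proof (rule Janiszewski_S2)
    show "closed (g \<union> d)" "g \<union> d \<subseteq> S2" "g \<union> d \<noteq> {}" using closed_curve sub_S2 g p by auto
    show "closed T" "T \<subseteq> S2" by fact+
    show "T \<noteq> {}" using p'in unfolding T_def by blast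
    show "connected ((g \<union> d) \<inter> T)" using int conGD by simp
    show "connected_component (S2 - (g \<union> d)) a b"
      by (rule same_sides[OF g p]) (use component_connected[OF s] component_connected[OF t] a b C C' in blast)+
    show "connected_component (S2 - T) a b" using component_connected[OF U(1)] a b by blast
  qed
  then show ?thesis using cells_eqI[OF C(1) C'(1) a(1) b(1)] un by simp
qed

text \<open>The two edges of \<open>g\<close> at \<open>p\<close> lie on opposite sides of
  \<open>d\<close>, and \<open>C\<close> is on one of them. The cell along the edge on that side
  touches \<open>p\<close> from the same pair of sides as \<open>C\<close>, hence is
  \<open>C\<close>; bordering the other edge would put \<open>C\<close> on the wrong side.\<close>

lemma corner:
  assumes C: "C \<in> cells A" "p \<in> closure C" and g: "g \<in> A" "p \<in> g" "p \<in> X"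
  obtains e where "e \<in> E g" "p \<in> closure e" "e \<subseteq> closure C"
    "\<And>e'. e' \<in> E g \<Longrightarrow> p \<in> closure e' \<Longrightarrow> e' \<subseteq> closure C \<Longrightarrow> e' = e"
proof -
  obtain d where d: "d \<in> A" "g \<noteq> d" "p \<in> d" using in_XD[OF g(3)] by metis
  obtain e1 e2 c1 c2 D1 D2 where e: "e1 \<in> E g" "e2 \<in> E g" "p \<in> closure e1" "p \<in> closure e2"
    "\<And>e. e \<in> E g \<Longrightarrow> p \<in> closure e \<Longrightarrow> e = e1 \<or> e = e2"
    and D: "D1 \<in> components (S2 - d)" "D2 \<in> components (S2 - d)" "D1 \<noteq> D2"
    "e1 \<subseteq> c1" "e2 \<subseteq> c2" "c1 \<subseteq> D1" "c2 \<subseteq> D2"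
    by (rule crossing_edges[OF g(1) d(1) d(2) g(2) d(3)]) blast
  obtain s where s: "s \<in> components (S2 - g)" "C \<subseteq> s" using cell_side[OF C(1) g(1)] .
  obtain t where t: "t \<in> components (S2 - d)" "C \<subseteq> t" using cell_side[OF C(1) d(1)] .
  have ok: "e \<subseteq> closure C" if ee: "e \<in> E g" "p \<in> closure e" "e \<subseteq> t" for e
  proof -
    obtain C' where C': "C' \<in> cells A" "C' \<subseteq> s" "e \<subseteq> closure C'" using edge_cell[OF g(1) ee(1) s(1)] .
    have "C' \<subseteq> t" using side_of_edge[OF C'(1) g(1) ee(1) d(1) _ t(1) ee(3) C'(3)] d by simp
    moreover have "p \<in> closure C'" using ee(2) closure_minimal[OF C'(3) closed_closure] by blast
    ultimately have "C = C'"
      using cell_unique[OF g(1) d(1,2) g(2) d(3) s(1) t(1) C s(2) t(2) C'(1) _ C'(2)] by blast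
    then show ?thesis using C'(3) by simp
  qed
  have bad: "t = D" if ee: "e \<in> E g" "e \<subseteq> D" "D \<in> components (S2 - d)" "e \<subseteq> closure C" for e D
  proof -
    have "C \<subseteq> D" using side_of_edge[OF C(1) g(1) ee(1) d(1) _ ee(3,2,4)] d by simp
    then have "t \<inter> D \<noteq> {}" using t(2) cell_props(2)[OF C(1)] by blast
    then show ?thesis using components_eq[OF t(1) ee(3)] by blast
  qed
  have sub: "e1 \<subseteq> D1" "e2 \<subseteq> D2" using D by auto
  have "t = D1 \<or> t = D2" using comp_two[OF d(1) D(1,2,3) t(1)] .
  then show thesis
  proof
    assume "t = D1"
    then show thesis using that[OF e(1,3)] ok[OF e(1,3)] bad[OF e(2) sub(2) D(2)] e(5) D(3) sub by metis
  next
    assume "t = D2"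
    then show thesis using that[OF e(2,4)] ok[OF e(2,4)] bad[OF e(1) sub(1) D(1)] e(5) D(3) sub by metis
  qed
qed

text \<open>The boundary edge \<open>e\<close> decides on which side of \<open>d\<close> the cells
  lie, and \<open>f\<close> decides the side of \<open>g\<close>.\<close>

lemma cell_unique_edges:
  assumes g: "g \<in> A" "d \<in> A" "g \<noteq> d" and p: "p \<in> g" "p \<in> d"
    and C: "C \<in> cells A" "p \<in> closure C" and C': "C' \<in> cells A" "p \<in> closure C'"
    and e: "e \<in> E g" "e \<subseteq> closure C" "e \<subseteq> closure C'" and f: "f \<in> E d" "f \<subseteq> closure C" "f \<subseteq> closure C'"
  shows "C = C'"
proof -
  have "e \<subseteq> S2 - d" "f \<subseteq> S2 - g"
    using edge_sub(1)[OF g(1) e(1)] edge_disjoint[OF g(1) e(1) g(2)] edge_sub(1)[OF g(2) f(1)] 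
      edge_disjoint[OF g(2) f(1) g(1)] sub_S2 g by blast+
  then obtain s t where st: "s \<in> components (S2 - g)" "f \<subseteq> s" "t \<in> components (S2 - d)" "e \<subseteq> t"
    using component_of edge_sub(3,4) g e f by metis
  show ?thesis
    using cell_unique[OF g p st(1,3) C _ _ C']
      side_of_edge[OF C(1) g(1) e(1) g(2) _ st(3,4) e(2)] side_of_edge[OF C'(1) g(1) e(1) g(2) _ st(3,4) e(3)]
      side_of_edge[OF C(1) g(2) f(1) g(1) _ st(1,2) f(2)] side_of_edge[OF C'(1) g(2) f(1) g(1) _ st(1,2) f(3)]
      g(3) by blast
qed

section \<open>Triangular cells as triples of consecutive crossings\<close>

definition adj :: "(real^3) set \<Rightarrow> real^3 \<Rightarrow> real^3 \<Rightarrow> bool" where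
  "adj g p q \<longleftrightarrow> p \<noteq> q \<and> (\<exists>e\<in>E g. closure e \<inter> X = {p, q})"

lemma edge_unique:
  assumes g: "g \<in> A" and e: "e \<in> E g" "e' \<in> E g" "closure e \<inter> X = closure e' \<inter> X"
  shows "e = e'"
proof -
  obtain p where p: "p \<in> g" "p \<in> X" "p \<in> closure e" by (rule closure_edge[OF g e(1)]) blast
  then have pX: "p \<in> g \<inter> X" by blast
  obtain e1 e2 q1 q2 where v: "e1 \<in> E g" "e2 \<in> E g" 
      "closure e1 \<inter> (g \<inter> X) = {p, q1}" "closure e2 \<inter> (g \<inter> X) = {p, q2}" "q1 \<noteq> q2"
      "\<And>e. e \<in> E g \<Longrightarrow> p \<in> closure e \<Longrightarrow> e = e1 \<or> e = e2"
    by (rule marked_curve.vertex_props[OF marked[OF g] pX]) blast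
  have "p \<in> closure e'" using p e(3) by blast
  then have "e = e1 \<or> e = e2" "e' = e1 \<or> e' = e2" using v(6) e p by blast+
  moreover have "closure e1 \<inter> X \<noteq> closure e2 \<inter> X"
    using v(3-5) closure_edge_X[OF g v(1)] closure_edge_X[OF g v(2)] by (simp add: doubleton_eq_iff)
  ultimately show ?thesis using e(3) by metis
qed

sublocale cs: curve_system A X adj
proof
  show "finite X" by (rule finite_X)
  show "\<exists>g\<in>A. \<exists>d\<in>A. g \<noteq> d \<and> p \<in> g \<and> p \<in> d" if "p \<in> X" for p using in_XD[OF that] by metis
  show "p \<in> X" if "g \<in> A" "d \<in> A" "g \<noteq> d" "p \<in> g" "p \<in> d" for g d p using in_XI that .
  show "p \<notin> e" if "g \<in> A" "d \<in> A" "e \<in> A" "g \<noteq> d" "g \<noteq> e" "d \<noteq> e" "p \<in> g" "p \<in> d" for g d e p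
    using only_two[of g d p e] that by blast
  show "q = r" if h: "g \<in> A" "d \<in> A" "g \<noteq> d" "p \<in> g" "p \<in> d" "q \<in> g" "q \<in> d" "r \<in> g" "r \<in> d" "p \<noteq> q" "p \<noteq> r"
    for g d p q r
  proof (rule ccontr)
    assume "q \<noteq> r"
    have "g \<inter> d \<noteq> {}" using h by blast
    then have "card (g \<inter> d) = 2" using card_Int h by blast
    moreover have "card {p, q, r} \<le> card (g \<inter> d)"
      using card_mono[of "g \<inter> d" "{p, q, r}"] calculation h card.infinite by fastforce
    ultimately show False using h \<open>q \<noteq> r\<close> by simp
  qed
  show "p \<in> g \<and> p \<in> X \<and> p \<noteq> q" if g: "g \<in> A" and adj: "adj g p q" for g p q
  proof -
    obtain e where e: "e \<in> E g" "closure e \<inter> X = {p, q}" "p \<noteq> q" using adj unfolding adj_def by blast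
    have "closure e \<inter> X \<subseteq> g" using closure_edge_X[OF g e(1)] by blast
    then show ?thesis using e by blast
  qed
  show "adj g q p" if "adj g p q" for g p q using that unfolding adj_def by (metis insert_commute)
  show "\<exists>q1 q2. q1 \<noteq> q2 \<and> (\<forall>q. adj g p q \<longleftrightarrow> q = q1 \<or> q = q2)" if g: "g \<in> A" and p: "p \<in> g" "p \<in> X" for g p
  proof -
    have pX: "p \<in> g \<inter> X" using p by blast
    obtain e1 e2 q1 q2 where v: "e1 \<in> E g" "e2 \<in> E g" 
        "closure e1 \<inter> (g \<inter> X) = {p, q1}" "closure e2 \<inter> (g \<inter> X) = {p, q2}" "q1 \<noteq> q2" "q1 \<noteq> p" "q2 \<noteq> p"
        "\<And>e. e \<in> E g \<Longrightarrow> p \<in> closure e \<Longrightarrow> e = e1 \<or> e = e2"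
      by (rule marked_curve.vertex_props[OF marked[OF g] pX]) blast
    have v': "closure e1 \<inter> X = {p, q1}" "closure e2 \<inter> X = {p, q2}"
      using v(3,4) closure_edge_X[OF g v(1)] closure_edge_X[OF g v(2)] by auto
    have "adj g p q \<longleftrightarrow> q = q1 \<or> q = q2" for q
    proof
      assume "adj g p q"
      then obtain e where e: "e \<in> E g" "closure e \<inter> X = {p, q}" "p \<noteq> q" unfolding adj_def by blast
      then have "e = e1 \<or> e = e2" using v(8) by blast
      then show "q = q1 \<or> q = q2" using v' e by (metis doubleton_eq_iff)
    next
      assume "q = q1 \<or> q = q2" then show "adj g p q" unfolding adj_def using v v' by blast
    qed
    then show ?thesis using v(5) by blast
  qed
  show "S = g \<inter> X" if g: "g \<in> A" and S: "S \<subseteq> g \<inter> X" "S \<noteq> {}" and cl: "\<And>p q. p \<in> S \<Longrightarrow> adj g p q \<Longrightarrow> q \<in> S" for g S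
  proof (rule marked_curve.closed_under_ends[OF marked[OF g] S])
    fix e assume e: "e \<in> E g" "closure e \<inter> S \<noteq> {}"
    obtain p q where pq: "p \<noteq> q" "closure e \<inter> X = {p, q}" by (rule closure_edge[OF g e(1)]) blast
    then have "adj g p q" "adj g q p" unfolding adj_def using e(1) by (auto simp: insert_commute)
    moreover have "p \<in> S \<or> q \<in> S"
    proof -
      obtain z where "z \<in> S" "z \<in> closure e" using e(2) by blast
      then have "z \<in> closure e \<inter> X" using S by blast
      then show ?thesis using \<open>z \<in> S\<close> unfolding pq(2) by blast
    qed
    ultimately have "{p, q} \<subseteq> S" using cl by blast
    then show "closure e \<inter> (g \<inter> X) \<subseteq> S" unfolding closure_edge_X[OF g e(1)] pq(2) .
  qed
  show "4 < card (g \<inter> X)" if "g \<in> A" for g using card_on_curve[OF that] by simp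
qed

lemma corner_nbr:
  assumes C: "C \<in> cells A" "p \<in> closure C" and g: "g \<in> A" "p \<in> g" "p \<in> X"
  obtains e q where "e \<in> E g" "e \<subseteq> closure C" "closure e \<inter> X = {p, q}" "p \<noteq> q" "q \<in> X \<inter> closure C" "q \<in> g"
    "\<And>e'. e' \<in> E g \<Longrightarrow> p \<in> closure e' \<Longrightarrow> e' \<subseteq> closure C \<Longrightarrow> e' = e"
proof -
  obtain e where e: "e \<in> E g" "p \<in> closure e" "e \<subseteq> closure C"
    "\<And>e'. e' \<in> E g \<Longrightarrow> p \<in> closure e' \<Longrightarrow> e' \<subseteq> closure C \<Longrightarrow> e' = e"
    by (rule corner[OF C g]) blast
  obtain x y where xy: "x \<noteq> y" "closure e \<inter> X = {x, y}" "x \<in> g" "y \<in> g" by (rule closure_edge[OF g(1) e(1)]) blast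
  have sub: "closure e \<subseteq> closure C" using closure_minimal[OF e(3) closed_closure] .
  have "p = x \<or> p = y" using e(2) xy g by blast
  then show thesis
  proof
    assume "p = x" then show thesis using that[OF e(1,3), of y] xy sub e(4) by blast
  next
    assume "p = y" then show thesis using that[OF e(1,3), of x] xy sub e(4) by blast
  qed
qed

text \<open>The boundary leaves \<open>p\<close> along \<open>g\<close> to \<open>q\<close> and
  along \<open>d\<close> to \<open>r\<close>. Each corner has a single boundary edge on each of its
  two curves, so these either form a digon, which has no room for a third corner, or are completed
  by an edge from \<open>q\<close> to \<open>r\<close>.\<close>

lemma triangle_corners:
  assumes C: "C \<in> triangles A" and p: "p \<in> X \<inter> closure C" and g: "g \<in> A" "d \<in> A" "g \<noteq> d" "p \<in> g" "p \<in> d"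
  obtains e f q r a where "e \<in> E g" "f \<in> E d" "e \<subseteq> closure C" "f \<subseteq> closure C" "X \<inter> closure C = {p, q, r}"
    "closure e \<inter> X = {p, q}" "closure f \<inter> X = {p, r}" "a \<in> A" "a \<noteq> g" "a \<noteq> d" "adj g p q" "adj d p r" "adj a q r"
proof -
  have C': "C \<in> cells A" using C unfolding triangles_def by auto
  \<comment> \<open>Here \<open>frontier\<close> refers to the ambient space \<open>real^3\<close>.
    It differs from the closure by the interior, which lies in \<open>C\<close> and so contains no
    crossing.\<close>
  have "X \<inter> interior C = {}"
    using cell_props(3)[OF C'] interior_subset[of C] unfolding crossings_def by blast
  then have "X \<inter> frontier C = X \<inter> closure C" unfolding frontier_def by blast
  then have card3: "card (X \<inter> closure C) = 3" using C unfolding triangles_def by auto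
  let ?V = "X \<inter> closure C"
  have pX: "p \<in> X" "p \<in> closure C" using p by auto
  obtain e q where e: "e \<in> E g" "e \<subseteq> closure C" "closure e \<inter> X = {p, q}" "p \<noteq> q" "q \<in> ?V" "q \<in> g"
    "\<And>e'. e' \<in> E g \<Longrightarrow> p \<in> closure e' \<Longrightarrow> e' \<subseteq> closure C \<Longrightarrow> e' = e"
    by (rule corner_nbr[OF C' pX(2) g(1,4) pX(1)]) blast
  obtain f r where f: "f \<in> E d" "f \<subseteq> closure C" "closure f \<inter> X = {p, r}" "p \<noteq> r" "r \<in> ?V" "r \<in> d"
    "\<And>f'. f' \<in> E d \<Longrightarrow> p \<in> closure f' \<Longrightarrow> f' \<subseteq> closure C \<Longrightarrow> f' = f"
    by (rule corner_nbr[OF C' pX(2) g(2,5) pX(1)]) blast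
  have uniq: "e1 = e2" if h: "h \<in> A" "v \<in> h" "v \<in> ?V" and
    e1: "e1 \<in> E h" "v \<in> closure e1" "e1 \<subseteq> closure C" and e2: "e2 \<in> E h" "v \<in> closure e2" "e2 \<subseteq> closure C" for h v e1 e2
  proof -
    have "v \<in> closure C" "v \<in> X" using h by auto
    then obtain e0 where "\<And>e'. e' \<in> E h \<Longrightarrow> v \<in> closure e' \<Longrightarrow> e' \<subseteq> closure C \<Longrightarrow> e' = e0"
      using corner[OF C' _ h(1,2)] by metis
    then show ?thesis using e1 e2 by metis
  qed
  \<comment> \<open>In a digon a third corner \<open>w\<close> would have a boundary edge leading to
    \<open>p\<close> or \<open>q\<close>, but the boundary edges there are \<open>e\<close> and
    \<open>f\<close>, neither of which ends in \<open>w\<close>.\<close>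
  have qr: "q \<noteq> r"
  proof
    assume qr: "q = r"
    have "\<not> ?V \<subseteq> {p, q}"
    proof
      assume "?V \<subseteq> {p, q}"
      then have "card ?V \<le> card {p, q}" by (rule card_mono[rotated]) auto
      then show False using card3 by (simp add: card_insert_if split: if_splits)
    qed
    then obtain w where w: "w \<in> ?V" "w \<noteq> p" "w \<noteq> q" by blast
    have "card {p, q, w} = card ?V" using w e(4) card3 by simp
    moreover have "finite ?V" using finite_X by simp
    ultimately have V: "?V = {p, q, w}" using card_subset_eq[of ?V "{p, q, w}"] w e(5) p by auto
    have wX: "w \<in> X" "w \<in> closure C" using w by auto
    obtain h k where h: "h \<in> A" "w \<in> h" using in_XD[OF wX(1)] by metis
    obtain e' w' where e': "e' \<in> E h" "e' \<subseteq> closure C" "closure e' \<inter> X = {w, w'}" "w \<noteq> w'" "w' \<in> ?V" "w' \<in> h"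
      by (rule corner_nbr[OF C' wX(2) h wX(1)]) blast
    have inv: "w' \<in> closure e'" "w \<in> closure e'" using e'(3) by auto
    have "w' = p \<or> w' = q" using e' V by auto
    then have "h = g \<or> h = d"
    proof
      assume "w' = p" then show ?thesis using only_two[OF g h(1)] e'(6) by simp
    next
      assume "w' = q" then show ?thesis using only_two[OF g(1-3) e(6) _ h(1)] e'(6) f(6) qr by simp
    qed
    moreover have "w' \<in> closure e" "w' \<in> closure f" using \<open>w' = p \<or> w' = q\<close> e(3) f(3) qr by auto
    ultimately have "e' = e \<or> e' = f"
      using uniq[OF h(1) e'(6,5) e'(1) inv(1) e'(2)] e(1,2) f(1,2) by blast
    then show False using inv(2) wX w e(3) f(3) qr by blast
  qed
  have "card {p, q, r} = card ?V" using qr e(4) f(4) card3 by simp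
  moreover have "finite ?V" using finite_X by simp
  ultimately have V: "?V = {p, q, r}" using card_subset_eq[of ?V "{p, q, r}"] e(5) f(5) p by auto
  have qX: "q \<in> X" "q \<in> closure C" using e(5) by auto
  obtain a where a: "a \<in> A" "a \<noteq> g" "q \<in> a" using in_XD[OF qX(1)] by metis
  obtain e' w where e': "e' \<in> E a" "e' \<subseteq> closure C" "closure e' \<inter> X = {q, w}" "q \<noteq> w" "w \<in> ?V" "w \<in> a"
    by (rule corner_nbr[OF C' qX(2) a(1,3) qX(1)]) blast
  have inv: "w \<in> closure e'" "q \<in> closure e'" using e'(3) by auto
  \<comment> \<open>A boundary edge from \<open>q\<close> back to \<open>p\<close> along
    \<open>a\<close> would be \<open>f\<close>, whose other end is \<open>r\<close>.\<close>
  have "w \<noteq> p"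
  proof
    assume wp: "w = p"
    then have "a = d" using only_two[OF g a(1)] e'(6) a(2) by blast
    then have "e' = f" using f(7)[of e'] e' inv wp by blast
    then have "q \<in> closure f \<inter> X" using inv(2) qX by blast
    then show False using f(3) e(4) qr by simp
  qed
  then have w: "w = r" using e'(4,5) V by blast
  have "a \<noteq> d"
  proof
    assume "a = d"
    then have "e' = f" using uniq[OF a(1) e'(6,5) e'(1) inv(1) e'(2)] f(1,2,3) w by blast
    then have "q \<in> closure f \<inter> X" using inv(2) qX by blast
    then show False using f(3) e(4) qr by simp
  qed
  moreover have "adj g p q" "adj d p r" "adj a q r" unfolding adj_def using e f e' w by blast+
  ultimately show thesis using that[OF e(1) f(1) e(2) f(2) V e(3) f(3) a(1,2)] by blast
qed

lemma triangle_vertex: assumes "C \<in> triangles A"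
  obtains p g d where "p \<in> X \<inter> closure C" "g \<in> A" "d \<in> A" "g \<noteq> d" "p \<in> g" "p \<in> d"
proof -
  have "card (X \<inter> frontier C) = 3" using assms unfolding triangles_def by auto
  then have "X \<inter> frontier C \<noteq> {}" by auto
  then obtain p where "p \<in> X" "p \<in> closure C" unfolding frontier_def by blast
  then show thesis using in_XD[of p] that by blast
qed

lemma triangle_Tri: assumes C: "C \<in> triangles A" shows "X \<inter> closure C \<in> cs.Tri"
proof -
  obtain p g d where *: "p \<in> X \<inter> closure C" "g \<in> A" "d \<in> A" "g \<noteq> d" "p \<in> g" "p \<in> d"
    using triangle_vertex[OF C] .
  show ?thesis
    by (rule triangle_corners[OF C *]) (use * in \<open>unfold cs.Tri_def, blast\<close>)
qed

text \<open>Given the corner set, the neighbour of \<open>p\<close> on \<open>g\<close> and the one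
  on \<open>d\<close> are known, hence so are the two boundary edges at \<open>p\<close>, and these
  determine the cell.\<close>

lemma inj_triangles: "inj_on (\<lambda>C. X \<inter> closure C) (triangles A)"
proof (rule inj_onI)
  fix C C' assume C: "C \<in> triangles A" "C' \<in> triangles A" and eq: "X \<inter> closure C = X \<inter> closure C'"
  obtain p g d where *: "p \<in> X \<inter> closure C" and g: "g \<in> A" "d \<in> A" "g \<noteq> d" "p \<in> g" "p \<in> d"
    using triangle_vertex[OF C(1)] .
  obtain e f q r a where e: "e \<in> E g" "f \<in> E d" "e \<subseteq> closure C" "f \<subseteq> closure C" "X \<inter> closure C = {p, q, r}"
    "closure e \<inter> X = {p, q}" "closure f \<inter> X = {p, r}" "adj g p q" "adj d p r"
    by (rule triangle_corners[OF C(1) * g]) blast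
  have pC': "p \<in> X \<inter> closure C'" using * eq by simp
  obtain e' f' q' r' where e': "e' \<in> E g" "f' \<in> E d" "e' \<subseteq> closure C'" "f' \<subseteq> closure C'" "X \<inter> closure C' = {p, q', r'}"
    "closure e' \<inter> X = {p, q'}" "closure f' \<inter> X = {p, r'}" "adj g p q'" "adj d p r'"
    by (rule triangle_corners[OF C(2) pC' g]) blast
  have T: "{p, q, r} \<in> cs.Tri" "{p, q', r'} \<in> cs.Tri" using triangle_Tri C e(5) e'(5) by metis+
  have 1: "q \<in> g" "r \<in> d" "q \<notin> d" "r \<notin> g" using cs.Tri_third[OF T(1) g(1-3) e(8,9)] by metis+
  have 2: "q' \<in> g" "r' \<in> d" "q' \<notin> d" "r' \<notin> g" using cs.Tri_third[OF T(2) g(1-3) e'(8,9)] by metis+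
  have "q \<noteq> p" "r \<noteq> p" "q' \<noteq> p" "r' \<noteq> p" using e(8,9) e'(8,9) unfolding adj_def by auto
  then have "q' = q" "r' = r" using 1 2 eq e(5) e'(5) by blast+
  then have "e = e'" "f = f'" using edge_unique[OF g(1) e(1) e'(1)] edge_unique[OF g(2) e(2) e'(2)] e e' by auto
  then show "C = C'"
    using cell_unique_edges[OF g, of C C' e f] * pC' e e' C unfolding triangles_def by blast
qed

lemma card_triangles: "6 * card (triangles A) \<le> 5 * card X"
proof -
  have "card (triangles A) \<le> card cs.Tri"
    by (rule card_inj_on_le[OF inj_triangles _ cs.finite_Tri]) (use triangle_Tri in blast)
  then show ?thesis using cs.card_Tri_le by linarith
qed

end

section \<open>Euler's inequality\<close>

text \<open>Each component of \<open>S'\<close> lies in one of \<open>S\<close>, and this assignment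
  is onto because every component of \<open>S\<close> meets \<open>S'\<close>. Two components with
  the same image make the inequality strict.\<close>

lemma components_refine:
  assumes sub: "S' \<subseteq> S" and fin: "finite (components S')"
    and meet: "\<And>U. U \<in> components S \<Longrightarrow> U \<inter> S' \<noteq> {}"
  shows "finite (components S)" "card (components S) \<le> card (components S')"
    and "\<lbrakk>W1 \<in> components S'; W2 \<in> components S'; W1 \<noteq> W2; U \<in> components S; W1 \<subseteq> U; W2 \<subseteq> U\<rbrakk>
      \<Longrightarrow> Suc (card (components S)) \<le> card (components S')"
proof -
  define \<phi> where "\<phi> W = (THE U. U \<in> components S \<and> W \<subseteq> U)" for W
  have \<phi>: "\<phi> W = U" if "W \<in> components S'" "U \<in> components S" "W \<subseteq> U" for W U
    unfolding \<phi>_def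
  proof (rule the_equality)
    show "U \<in> components S \<and> W \<subseteq> U" using that by auto
    fix V assume V: "V \<in> components S \<and> W \<subseteq> V"
    have "W \<noteq> {}" using in_components_nonempty[OF that(1)] .
    then show "V = U" using components_eq[of V S U] V that by blast
  qed
  have ex: "\<exists>W\<in>components S'. W \<subseteq> U" if U: "U \<in> components S" for U
  proof -
    obtain x where x: "x \<in> U" "x \<in> S'" using meet[OF U] by blast
    define W where "W = connected_component_set S' x"
    have W: "W \<in> components S'" "x \<in> W" using x by (auto simp: W_def componentsI connected_component_refl)
    then have "W \<subseteq> U"
      using components_maximal[OF U, of W] in_components_connected[OF W(1)] in_components_subset[OF W(1)] sub x by blast
    then show ?thesis using W by blast
  qed
  have im: "components S \<subseteq> \<phi> ` components S'"
  proof
    fix U assume U: "U \<in> components S"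
    then obtain W where "W \<in> components S'" "W \<subseteq> U" using ex by blast
    then show "U \<in> \<phi> ` components S'" using \<phi>[of W U] U by blast
  qed
  show "finite (components S)" using finite_surj[OF fin im] .
  show "card (components S) \<le> card (components S')" using surj_card_le[OF fin im] .
  show "Suc (card (components S)) \<le> card (components S')"
    if W: "W1 \<in> components S'" "W2 \<in> components S'" "W1 \<noteq> W2" "U \<in> components S" "W1 \<subseteq> U" "W2 \<subseteq> U"
  proof -
    have eq: "\<phi> W1 = \<phi> W2" using \<phi> W by simp
    have "components S \<subseteq> \<phi> ` (components S' - {W1})"
    proof
      fix V assume "V \<in> components S"
      then obtain W where "W \<in> components S'" "V = \<phi> W" using im by blast
      then show "V \<in> \<phi> ` (components S' - {W1})" using eq W by (cases "W = W1") auto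
    qed
    then have "card (components S) \<le> card (components S' - {W1})" by (rule surj_card_le[rotated]) (use fin in simp)
    also have "Suc (card (components S' - {W1})) = card (components S')" using card_Suc_Diff1[OF fin W(1)] .
    finally show ?thesis by simp
  qed
qed

text \<open>Path components rather than components: closing up a Jordan curve takes an arc inside
  the skeleton.\<close>

definition path_comps :: "'a::topological_space set \<Rightarrow> 'a set set" where
  "path_comps K = path_component_set K ` K"

text \<open>The counterpart for a growing set: path components of \<open>K\<close> map onto those of
  \<open>K'\<close>, and a merger of two of them lowers the count.\<close>

lemma path_comps_add:
  assumes sub: "K \<subseteq> K'" and fin: "finite (path_comps K)"
    and reach: "\<And>z. z \<in> K' \<Longrightarrow> \<exists>k\<in>K. path_component K' z k"
  shows "finite (path_comps K')" "card (path_comps K') \<le> card (path_comps K)"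
    and "\<lbrakk>x \<in> K; y \<in> K; path_component K' x y; \<not> path_component K x y\<rbrakk>
      \<Longrightarrow> Suc (card (path_comps K')) \<le> card (path_comps K)"
proof -
  define \<Phi> where "\<Phi> Q = path_component_set K' (SOME k. k \<in> Q)" for Q
  have \<Phi>: "\<Phi> (path_component_set K k) = path_component_set K' k" if "k \<in> K" for k
  proof -
    have "path_component K k k" using that by (simp add: path_component_refl)
    then have "path_component K k (SOME k'. k' \<in> path_component_set K k)"
      by (metis mem_Collect_eq someI_ex)
    then have "path_component K' k (SOME k'. k' \<in> path_component_set K k)"
      using sub path_component_of_subset by metis
    then show ?thesis unfolding \<Phi>_def by (metis path_component_eq mem_Collect_eq)
  qed
  have im: "path_comps K' \<subseteq> \<Phi> ` path_comps K"
  proof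
    fix Q assume "Q \<in> path_comps K'"
    then obtain z where z: "z \<in> K'" "Q = path_component_set K' z" unfolding path_comps_def by blast
    then obtain k where k: "k \<in> K" "path_component K' z k" using reach by blast
    then have "Q = path_component_set K' k" using z by (metis path_component_eq mem_Collect_eq)
    then show "Q \<in> \<Phi> ` path_comps K" using \<Phi>[OF k(1)] k(1) unfolding path_comps_def by blast
  qed
  show "finite (path_comps K')" using finite_surj[OF fin im] .
  show "card (path_comps K') \<le> card (path_comps K)" using surj_card_le[OF fin im] .
  show "Suc (card (path_comps K')) \<le> card (path_comps K)"
    if xy: "x \<in> K" "y \<in> K" "path_component K' x y" "\<not> path_component K x y"
  proof -
    let ?x = "path_component_set K x" and ?y = "path_component_set K y"
    have in_x: "?x \<in> path_comps K" and in_y: "?y \<in> path_comps K" using xy unfolding path_comps_def by auto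
    have ne: "?x \<noteq> ?y" using xy(2,4) path_component_refl by (metis mem_Collect_eq)
    have eq: "\<Phi> ?x = \<Phi> ?y" using \<Phi> xy by (metis path_component_eq mem_Collect_eq)
    have "path_comps K' \<subseteq> \<Phi> ` (path_comps K - {?x})"
    proof
      fix V assume "V \<in> path_comps K'"
      then obtain W where W: "W \<in> path_comps K" "V = \<Phi> W" using im by blast
      show "V \<in> \<Phi> ` (path_comps K - {?x})"
      proof (cases "W = ?x")
        case True
        then have "V = \<Phi> ?y" using W eq by simp
        then show ?thesis using in_y ne by blast
      next
        case False then show ?thesis using W by blast
      qed
    qed
    then have "card (path_comps K') \<le> card (path_comps K - {?x})" by (rule surj_card_le[rotated]) (use fin in simp)
    also have "Suc (card (path_comps K - {?x})) = card (path_comps K)" using card_Suc_Diff1[OF fin in_x] .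
    finally show ?thesis by simp
  qed
qed

context arrangement
begin

text \<open>Each curve lies in the closure of its complement and so has empty interior in the
  sphere; being closed, the curves can be removed one at a time. Thus no face of a partial skeleton
  is used up by the edges still to come.\<close>

lemma open_not_covered:
  assumes "finite F" "F \<subseteq> A" "openin (top_of_set S2) U" "U \<noteq> {}"
  shows "\<not> U \<subseteq> \<Union>F"
  using assms
proof (induction F arbitrary: U rule: finite_induct)
  case empty then show ?case by auto
next
  case (insert g F)
  have g: "g \<in> A" using insert.prems by auto
  have "\<not> U \<subseteq> g"
  proof
    assume U: "U \<subseteq> g"
    obtain x where x: "x \<in> U" using insert.prems by auto
    obtain O' where O': "open O'" "U = S2 \<inter> O'" using insert.prems(2) unfolding openin_open by blast
    obtain C where C: "C \<in> components (S2 - g)" by (rule Jordan_S2[OF pc[OF g]]) blast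
    have "x \<in> closure C" using comp_closure[OF g C] x U by blast
    then have "C \<inter> O' \<noteq> {}" using O' x by (metis IntE closure_iff_nhds_not_empty inf_commute order_refl)
    then obtain c where c: "c \<in> C" "c \<in> O'" by blast
    then have "c \<in> S2" "c \<notin> g" using in_components_subset[OF C] by auto
    then show False using c O' U by blast
  qed
  then have "U - g \<noteq> {}" by blast
  moreover have "openin (top_of_set S2) (U - g)"
  proof -
    have "U - g = U \<inter> (S2 - g)" using openin_imp_subset[OF insert.prems(2)] by blast
    then show ?thesis using openin_Int[OF insert.prems(2) openin_S2_Diff[OF closed_curve[OF g]]] by simp
  qed
  ultimately have "\<not> U - g \<subseteq> \<Union>F" using insert by blast
  then show ?case by blast
qed

section \<open>Building the skeleton edge by edge\<close>

definition all_edges :: "(real^3) set set" where "all_edges = (\<Union>g\<in>A. E g)"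

text \<open>All crossings are present from the start, so an inserted edge always finds its two
  ends.\<close>

definition skel :: "(real^3) set set \<Rightarrow> (real^3) set" where "skel H = X \<union> \<Union>H"

lemma all_edgesE: assumes "e \<in> all_edges" obtains g where "g \<in> A" "e \<in> E g"
  using assms unfolding all_edges_def by blast

lemma skel_sub: "H \<subseteq> all_edges \<Longrightarrow> skel H \<subseteq> \<Union>A"
proof -
  assume H: "H \<subseteq> all_edges"
  have "\<Union>H \<subseteq> \<Union>A"
  proof
    fix x assume "x \<in> \<Union>H"
    then obtain e where e: "e \<in> H" "x \<in> e" by blast
    then obtain g where "g \<in> A" "e \<in> E g" using H all_edgesE by blast
    then show "x \<in> \<Union>A" using edge_sub(1) e by blast
  qed
  moreover have "X \<subseteq> \<Union>A" unfolding crossings_def by blast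
  ultimately show ?thesis unfolding skel_def by blast
qed

lemma skel_S2: "H \<subseteq> all_edges \<Longrightarrow> skel H \<subseteq> S2"
  using skel_sub sub_S2 by blast

lemma finite_all_edges: "finite all_edges"
  unfolding all_edges_def using finite_A marked_curve.finite_edges[OF marked] by blast

lemma closed_skel: assumes "H \<subseteq> all_edges" shows "closed (skel H)"
proof -
  have "\<Union>(closure ` H) \<subseteq> skel H"
  proof
    fix x assume "x \<in> \<Union>(closure ` H)"
    then obtain e where e: "e \<in> H" "x \<in> closure e" by blast
    then obtain g where g: "g \<in> A" "e \<in> E g" using assms all_edgesE by blast
    obtain p q where "p \<in> X" "q \<in> X" "closure e = e \<union> {p, q}" by (rule closure_edge[OF g]) blast
    then show "x \<in> skel H" unfolding skel_def using e by auto
  qed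
  moreover have "skel H \<subseteq> X \<union> \<Union>(closure ` H)" unfolding skel_def using closure_subset by blast
  ultimately have "skel H = X \<union> \<Union>(closure ` H)" unfolding skel_def by blast
  moreover have "closed (X \<union> \<Union>(closure ` H))"
    using finite_X finite_subset[OF assms finite_all_edges] by (intro closed_Un closed_Union) (auto intro: finite_imp_closed)
  ultimately show ?thesis by simp
qed

lemma skel_all: "skel all_edges = \<Union>A"
proof
  show "skel all_edges \<subseteq> \<Union>A" using skel_sub by simp
  show "\<Union>A \<subseteq> skel all_edges"
    unfolding skel_def all_edges_def using marked_curve.edge_cover[OF marked] by blast
qed

lemma edge_eqI:
  assumes "g \<in> A" "e \<in> E g" "g' \<in> A" "e' \<in> E g'" "e \<inter> e' \<noteq> {}" shows "e = e' \<and> g = g'"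
proof -
  have "g = g'"
  proof (rule ccontr)
    assume "g \<noteq> g'"
    then show False using edge_disjoint[of g e g'] edge_sub(1)[of g' e'] assms by blast
  qed
  then show ?thesis using marked_curve.edges_disjoint[OF marked[OF assms(1)]] assms by metis
qed

text \<open>Every curve has as many edges as crossings, and every crossing lies on two
  curves.\<close>

lemma card_all_edges: "card all_edges = 2 * card X"
proof -
  have "card all_edges = (\<Sum>g\<in>A. card (E g))"
    unfolding all_edges_def
  proof (rule card_UN_disjoint[OF finite_A])
    show "\<forall>g\<in>A. finite (E g)" using marked_curve.finite_edges[OF marked] by blast
    show "\<forall>g\<in>A. \<forall>d\<in>A. g \<noteq> d \<longrightarrow> E g \<inter> E d = {}"
    proof (intro ballI impI)
      fix g d assume gd: "g \<in> A" "d \<in> A" "g \<noteq> d"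
      have "e \<notin> E d" if "e \<in> E g" for e
        using edge_eqI[OF gd(1) that gd(2), of e] edge_sub(3)[OF gd(1) that] gd(3) by auto
      then show "E g \<inter> E d = {}" by blast
    qed
  qed
  also have "\<dots> = (\<Sum>g\<in>A. card {p \<in> X. p \<in> g})"
  proof (rule sum.cong[OF refl])
    fix g assume "g \<in> A"
    moreover have "{p \<in> X. p \<in> g} = g \<inter> X" by blast
    ultimately show "card (E g) = card {p \<in> X. p \<in> g}" using marked_curve.card_edges[OF marked] by simp
  qed
  also have "\<dots> = (\<Sum>p\<in>X. card {g \<in> A. p \<in> g})"
    by (rule sum_multicount_gen) (auto simp: finite_X finite_A)
  also have "\<dots> = (\<Sum>p\<in>X. 2)"
  proof (rule sum.cong[OF refl])
    fix p assume "p \<in> X"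
    then obtain g d where g: "g \<in> A" "d \<in> A" "g \<noteq> d" "p \<in> g" "p \<in> d" using in_XD by metis
    then have "{g \<in> A. p \<in> g} = {g, d}" using only_two[OF g] by blast
    then show "card {g \<in> A. p \<in> g} = 2" using g(3) by simp
  qed
  finally show ?thesis by simp
qed

text \<open>Joining two points of the same path component by an edge closes a Jordan curve, both of whose
  sides meet the face containing the edge.\<close>

lemma edge_splits:
  assumes H: "H \<subseteq> all_edges" and g: "g \<in> A" "e \<in> E g" "e \<notin> H" and xy: "closure e = e \<union> {x, y}" "x \<noteq> y"
    and arc: "arc \<gamma>" "path_image \<gamma> = closure e" "pathstart \<gamma> = x" "pathfinish \<gamma> = y"
    and pc: "path_component (skel H) x y"
  obtains W1 W2 U where "W1 \<in> components (S2 - skel (insert e H))" "W2 \<in> components (S2 - skel (insert e H))"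
    "W1 \<noteq> W2" "U \<in> components (S2 - skel H)" "W1 \<subseteq> U" "W2 \<subseteq> U"
proof -
  have eH: "e \<inter> skel H = {}"
  proof -
    have "e \<inter> f = {}" if f: "f \<in> H" for f
    proof (rule ccontr)
      assume "e \<inter> f \<noteq> {}"
      moreover obtain h where "h \<in> A" "f \<in> E h" using f H all_edgesE by blast
      ultimately have "e = f" using edge_eqI g by metis
      then show False using f g(3) by simp
    qed
    then show ?thesis unfolding skel_def using edge_sub(2)[OF g(1,2)] by blast
  qed
  have skel': "skel (insert e H) = skel H \<union> e" unfolding skel_def by blast
  let ?P = "path_component_set (skel H) x"
  have "path_connected ?P" by simp
  moreover have "x \<in> ?P" "y \<in> ?P" using pc path_component_mem(1)[OF pc] by (auto simp: path_component_refl)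
  ultimately obtain \<beta> where \<beta>: "arc \<beta>" "path_image \<beta> \<subseteq> ?P" "pathstart \<beta> = y" "pathfinish \<beta> = x"
    using xy(2) unfolding path_connected_arcwise by metis
  then have \<beta>sub: "path_image \<beta> \<subseteq> skel H" using path_component_subset[of "skel H" x] by blast
  have "simple_path (\<gamma> +++ \<beta>)"
  proof (rule simple_path_join_loop)
    show "path_image \<gamma> \<inter> path_image \<beta> \<subseteq> {pathstart \<gamma>, pathstart \<beta>}"
      unfolding arc(2,3) \<beta>(3) xy(1) using \<beta>sub eH by blast
  qed (use arc \<beta> in auto)
  moreover have "path_image (\<gamma> +++ \<beta>) = closure e \<union> path_image \<beta>" using arc \<beta> by (simp add: path_image_join)
  moreover define J where "J = closure e \<union> path_image \<beta>"
  moreover have xyS: "x \<in> skel H" "y \<in> skel H" using path_component_mem[OF pc] by auto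
  then have Jsub: "J \<subseteq> skel H \<union> e" unfolding J_def using xy(1) \<beta>sub by blast
  moreover have "skel H \<union> e \<subseteq> S2" using skel_S2[OF H] sub_S2[OF g(1)] edge_sub(1)[OF g(1,2)] by blast
  moreover have "pathfinish (\<gamma> +++ \<beta>) = pathstart (\<gamma> +++ \<beta>)" using arc \<beta> by simp
  ultimately have J: "pseudocircle J" unfolding pseudocircle_iff by blast
  have eJ: "e \<subseteq> J" unfolding J_def using closure_subset by blast
  obtain C D where CD: "C \<noteq> D" "components (S2 - J) = {C, D}" "J \<subseteq> closure C" "J \<subseteq> closure D"
    using Jordan_S2[OF J] .
  then have CDc: "C \<in> components (S2 - J)" "D \<in> components (S2 - J)" by auto
  obtain z where z: "z \<in> e" using edge_sub(3)[OF g(1,2)] by auto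
  then have "z \<in> S2 - skel H" using eH sub_S2[OF g(1)] edge_sub(1)[OF g(1,2)] by blast
  then obtain U where U: "U \<in> components (S2 - skel H)" "z \<in> U"
    by (metis componentsI connected_component_refl mem_Collect_eq)
  have get: "\<exists>W\<in>components (S2 - skel (insert e H)). W \<subseteq> U \<and> W \<inter> K \<noteq> {}"
    if K: "K \<in> components (S2 - J)" "J \<subseteq> closure K" for K
  proof -
    have KS: "K \<subseteq> S2 - J" using in_components_subset[OF K(1)] .
    have "z \<in> closure K" using K z eJ by blast
    then obtain c where c: "c \<in> K" "c \<in> U"
      using component_meets[OF closed_skel[OF H] U(1) U(2), of K UNIV] KS by blast
    then have "c \<in> S2 - skel (insert e H)" 
      using KS eJ in_components_subset[OF U(1)] unfolding skel' by blast
    then obtain W where W: "W \<in> components (S2 - skel (insert e H))" "c \<in> W"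
      by (metis componentsI connected_component_refl mem_Collect_eq)
    have "W \<subseteq> S2 - skel H" using in_components_subset[OF W(1)] unfolding skel' by blast
    then have "W \<subseteq> U" using component_sub[OF in_components_connected[OF W(1)] _ U(1)] c W by blast
    then show ?thesis using W c by blast
  qed
  obtain W1 where W1: "W1 \<in> components (S2 - skel (insert e H))" "W1 \<subseteq> U" "W1 \<inter> C \<noteq> {}" using get[OF CDc(1) CD(3)] by blast
  obtain W2 where W2: "W2 \<in> components (S2 - skel (insert e H))" "W2 \<subseteq> U" "W2 \<inter> D \<noteq> {}" using get[OF CDc(2) CD(4)] by blast
  have "W1 \<noteq> W2"
  proof
    assume eq: "W1 = W2"
    have "W1 \<subseteq> S2 - J" using in_components_subset[OF W1(1)] Jsub unfolding skel' by blast
    then have "W1 \<subseteq> C" "W1 \<subseteq> D"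
      using component_sub[OF in_components_connected[OF W1(1)]] CDc W1(3) W2(3) eq by blast+
    then have "C \<inter> D \<noteq> {}" using W1(3) by blast
    then show False using components_eq[OF CDc] CD(1) by blast
  qed
  then show thesis using that W1 W2 U by blast
qed

text \<open>Vertices minus edges plus faces is at least the number of path components of the
  skeleton. Finiteness of the cells passes to the faces of every partial skeleton, since each such
  face contains a cell; only then does \<open>card\<close> count them faithfully.\<close>

lemma euler_inequality:
  assumes fin: "finite (cells A)" and H: "H \<subseteq> all_edges"
  shows "finite (path_comps (skel H)) \<and> card (path_comps (skel H)) + card H \<le> card (components (S2 - skel H)) + card X"
proof -
  have finH: "finite (components (S2 - skel H'))"
    and refine: "\<And>U. U \<in> components (S2 - skel H') \<Longrightarrow> \<not> U \<subseteq> \<Union>A" if H': "H' \<subseteq> all_edges" for H'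
  proof -
    show *: "\<not> U \<subseteq> \<Union>A" if U: "U \<in> components (S2 - skel H')" for U
    proof -
      obtain O' where O': "open O'" "U = S2 \<inter> O'" using open_component[OF closed_skel[OF H'] U] .
      then have "openin (top_of_set S2) U" by (auto simp: openin_open)
      then show ?thesis using open_not_covered[OF finite_A order_refl] in_components_nonempty[OF U] by blast
    qed
    show "finite (components (S2 - skel H'))"
    proof (rule components_refine(1)[of "S2 - \<Union>A"])
      show "S2 - \<Union>A \<subseteq> S2 - skel H'" using skel_sub[OF H'] by blast
      show "finite (components (S2 - \<Union>A))" using fin unfolding cells_def .
      fix U assume U: "U \<in> components (S2 - skel H')"
      show "U \<inter> (S2 - \<Union>A) \<noteq> {}" using *[OF U] in_components_subset[OF U] by blast
    qed
  qed
  have "finite H" using H finite_all_edges finite_subset by blast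
  then show ?thesis using H
  proof (induction H rule: finite_induct)
    case empty
    have "skel {} = X" unfolding skel_def by simp
    then have "finite (path_comps (skel {}))" "card (path_comps (skel {})) \<le> card X"
      unfolding path_comps_def using finite_X by (simp_all add: card_image_le)
    then show ?case by simp
  next
    case (insert e H)
    let ?K = "skel H" and ?K' = "skel (insert e H)"
    have HA: "H \<subseteq> all_edges" "insert e H \<subseteq> all_edges" using insert.prems by auto
    have IH: "finite (path_comps ?K)" "card (path_comps ?K) + card H \<le> card (components (S2 - ?K)) + card X"
      using insert by auto
    obtain g where g: "g \<in> A" "e \<in> E g" using HA all_edgesE by blast
    obtain x y \<gamma> where xy: "x \<noteq> y" "x \<in> g \<inter> X" "y \<in> g \<inter> X" "closure e = e \<union> {x, y}"
      and arc: "arc \<gamma>" "path_image \<gamma> = closure e" "pathstart \<gamma> = x" "pathfinish \<gamma> = y"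
      by (rule marked_curve.edge_props[OF marked[OF g(1)] g(2)]) blast
    have K': "?K' = ?K \<union> e" unfolding skel_def by blast
    have xyK: "x \<in> ?K" "y \<in> ?K" using xy unfolding skel_def by auto
    have clK': "closure e \<subseteq> ?K'" using xyK K' xy(4) by blast
    have pathe: "path_component ?K' z x" if "z \<in> closure e" for z
    proof -
      have "path_connected (closure e)" using arc path_connected_path_image[of \<gamma>] arc_imp_path by metis
      then have "path_component (closure e) z x" using that xy(4) unfolding path_connected_component by blast
      then show ?thesis using clK' path_component_of_subset by metis
    qed
    have reach: "\<exists>k\<in>?K. path_component ?K' z k" if z: "z \<in> ?K'" for z
    proof (cases "z \<in> ?K")
      case True then show ?thesis using path_component_refl[of z ?K'] z by blast
    next
      case False
      then have "z \<in> closure e" using z K' closure_subset by blast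
      then show ?thesis using pathe xyK by blast
    qed
    have subK: "?K \<subseteq> ?K'" using K' by blast
    note add = path_comps_add[OF subK IH(1) reach]
    have meet: "U \<inter> (S2 - ?K') \<noteq> {}" if U: "U \<in> components (S2 - ?K)" for U
      using refine[OF HA(1) U] in_components_subset[OF U] skel_sub[OF HA(2)] by blast
    have subS: "S2 - ?K' \<subseteq> S2 - ?K" using K' by blast
    note ref = components_refine[OF subS finH[OF HA(2)] meet]
    have "card (path_comps ?K') + card (insert e H) \<le> card (components (S2 - ?K')) + card X"
    proof (cases "path_component ?K x y")
      case True
      obtain W1 W2 U where "W1 \<in> components (S2 - ?K')" "W2 \<in> components (S2 - ?K')"
        "W1 \<noteq> W2" "U \<in> components (S2 - ?K)" "W1 \<subseteq> U" "W2 \<subseteq> U"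
        using edge_splits[OF HA(1) g insert.hyps(2) xy(4,1) arc True] .
      then have "Suc (card (components (S2 - ?K))) \<le> card (components (S2 - ?K'))" using ref(3) by metis
      then show ?thesis using add(2) IH(2) insert.hyps by simp
    next
      case False
      have "path_component ?K' x y" using pathe[of y] xy(4) path_component_sym by blast
      then have "Suc (card (path_comps ?K')) \<le> card (path_comps ?K)" using add(3)[OF _ xyK] False by simp
      then show ?thesis using ref(2) IH(2) insert.hyps by simp
    qed
    then show ?case using add(1) by blast
  qed
qed

text \<open>The complete skeleton has \<open>2 * card X\<close> edges, so the faces must make up for
  a surplus of \<open>card X\<close> over the vertices.\<close>

lemma card_cells: assumes "finite (cells A)" shows "card X \<le> card (cells A)"
  using euler_inequality[OF assms, of all_edges] card_all_edges unfolding skel_all cells_def by simp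

end

theorem theorem6:
  shows "\<exists>c::real. c > 0 \<and>
    (\<forall>A. pc_arrangement A \<and> simple_arrangement A \<and>
         (\<forall>g\<in>A. card {d \<in> A. d \<noteq> g \<and> g \<inter> d \<noteq> {}} \<ge> 3)
      \<longrightarrow> real (card (triangles A)) / real (card (cells A))
            \<le> 5/6 + c / real (card A))"
\<comment> \<open>The witness 1 is arbitrary: the bound \<open>5/6\<close> is reached without an
  error term.\<close>
proof (intro exI[of _ 1] conjI allI impI)
  fix A :: "(real^3) set set"
  assume "pc_arrangement A \<and> simple_arrangement A \<and> (\<forall>g\<in>A. card {d \<in> A. d \<noteq> g \<and> g \<inter> d \<noteq> {}} \<ge> 3)"
  then interpret arrangement A by unfold_locales auto
  have "real (card (triangles A)) / real (card (cells A)) \<le> 5/6"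
  proof (cases "finite (cells A) \<and> cells A \<noteq> {}")
    case True
    then have "card (cells A) > 0" using card_gt_0_iff by blast
    moreover have "6 * card (triangles A) \<le> 5 * card (cells A)" using card_triangles card_cells True by fastforce
    then have "6 * real (card (triangles A)) \<le> 5 * real (card (cells A))" by linarith
    ultimately show ?thesis by (simp add: field_simps)
  next
    case False
    \<comment> \<open>Infinitely many cells would be counted as \<open>0\<close>, and division by \<open>0\<close> gives \<open>0\<close>.\<close>
    then have "card (cells A) = 0" by auto
    then show ?thesis by simp
  qed
  moreover have "0 \<le> 1 / real (card A)" by simp
  ultimately show "real (card (triangles A)) / real (card (cells A)) \<le> 5/6 + 1 / real (card A)" by linarith
qed simp

end
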